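(* Consider the model $Y_{i,j}=\mu(x_{i,j})+s(x_{i,j})e_{i,j}$, $1\le j\le m_i$, $1\le i\le n$, with $N_n=m_1+\cdots+m_n$ and errors $e_{i,j}$ as in the context, where condition (D) of the context holds. Let $\varpi_{i,j}(x)\ge0$, $x\in\mathbb R$, be nonrandom weights, and put $$F_n(x,y)=\sum_{i=1}^n\sum_{j=1}^{m_i}\varpi_{i,j}(x)\mathbf 1_{Y_{i,j}\le y},$$ $$D_n(\delta,x,y)=\{F_n(x,y+\delta)-\mathbb E[F_n(x,y+\delta)]\}-\{F_n(x,y)-\mathbb E[F_n(x,y)]\}.$$ Assume: (a) $\varpi_{i,j}(x)\le c$ uniformly for some constant $c<\infty$; $\mu(x_{i,j})$ is uniformly bounded; $s(x_{i,j})>0$ is uniformly bounded away from zero and infinity; (b) $\varpi_{i,j}(\cdot)=0$ outside a common bounded interval for all $i,j$, and there exist $\tau_n$ and $\phi_n$ such that $$\sup_{x\ne x'}\frac{|\varpi_{i,j}(x)-\varpi_{i,j}(x')|}{|x-x'|}\le\tau_n\ \text{ for all } i,j,\qquad \sup_x\sum_{i=1}^n\sum_{j=1}^{m_i}\varpi_{i,j}^2(x)\le\phi_n;$$ (c) $\delta_n\to0$, $\sup_n\log N_n/(\delta_n\phi_n)<\infty$, and $1/\delta_n+\tau_n$ grows no faster than a polynomial of $N_n$. Then $$\sup_{|\delta|\le\delta_n,\ x,y\in\mathbb R}|D_n(\delta,x,y)|=O_{\mathrm p}\left\{[\delta_n\phi_n(\log N_n)^3]^{1/2}\right\}.$$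
   Context: Asymptotics: all limits are taken along a sequence of designs $(n;m_1,\dots,m_n;x_{i,j})$, indexed by $n$, with $N_n=m_1+\cdots+m_n\to\infty$; the $m_i$, the points $x_{i,j}$ and the weights $\varpi_{i,j}$ may change along the sequence. $\mathbf 1$ is the indicator function and $\|Z\|_q=[\mathbb E|Z|^q]^{1/q}$. Errors: $\varepsilon_{i,j}$ ($i,j\in\mathbb Z$) are i.i.d. random variables, $G$ is a measurable function, and $e_{i,j}=G(\varepsilon_{i,j},\varepsilon_{i,j\pm1},\varepsilon_{i,j\pm2},\ldots)$ (a function of the whole two-sided sequence centred at $j$). Thus for each $i$, $\{e_{i,j}\}_j$ is an independent copy of the stationary process $e_j=G(\varepsilon_j,\varepsilon_{j\pm1},\varepsilon_{j\pm2},\ldots)$ with i.i.d. $\varepsilon_j$. (D) There are constants $q>0$, $\rho\in(0,1)$ with $\|e_0-e_0(k)\|_q=O(\rho^k)$ (as a function of $k\in\mathbb N$), where $e_0(k)=G(\varepsilon_0,\varepsilon_{\pm1},\ldots,\varepsilon_{\pm k},\varepsilon'_{\pm(k+1)},\varepsilon'_{\pm(k+2)},\ldots)$ and $\{\varepsilon'_j\}$ is an i.i.d. copy of $\{\varepsilon_j\}$.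
   Formalization: The formal theorem adds the assumption that the errors e_{i,j} have a bounded Lebesgue density; without it the claim is false, e.g. for i.i.d. signs e_{i,1}=±1 with m_i=1, tent weights, φ_n=n, δ_n=n^{-1/2}, where D_n has order n^{1/2}. *)

theory Defs
  imports "HOL-Probability.Probability" "HOL-Library.Landau_Symbols"
begin

definition Lq_norm :: "'a measure \<Rightarrow> real \<Rightarrow> ('a \<Rightarrow> real) \<Rightarrow> real" where
  "Lq_norm M q Z = (\<integral>\<omega>. \<bar>Z \<omega>\<bar> powr q \<partial>M) powr (1 / q)"

text \<open>
  In the error process the argument \<open>k\<close> of \<open>G\<close> is the position relative to the centre \<open>j\<close>.
\<close>

definition err :: "((int \<Rightarrow> real) \<Rightarrow> real) \<Rightarrow> (int \<Rightarrow> int \<Rightarrow> 'a \<Rightarrow> real) \<Rightarrow> int \<Rightarrow> int \<Rightarrow> 'a \<Rightarrow> real" where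
  "err G \<epsilon> i j \<omega> = G (\<lambda>k. \<epsilon> i (j + k) \<omega>)"

definition iid_array :: "'a measure \<Rightarrow> (int \<Rightarrow> int \<Rightarrow> 'a \<Rightarrow> real) \<Rightarrow> bool" where
  "iid_array M \<epsilon> \<longleftrightarrow>
     prob_space.indep_vars M (\<lambda>_. borel) (\<lambda>(i, j). \<epsilon> i j) UNIV \<and>
     (\<forall>i j. distr M borel (\<epsilon> i j) = distr M borel (\<epsilon> 0 0))"

text \<open>
  Condition (D) involves only the joint law of the innovations and of their independent copy, so
  it is stated on the canonical space: \<open>P\<close> is the law of one innovation, and a point \<open>(u, v)\<close> is
  the pair formed by the sequence \<open>u\<close> of innovations and its independent copy \<open>v\<close>. The
  integrability clause says that the norm is finite; it is needed because the Bochner integral of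
  a non-integrable function is \<open>0\<close>.
\<close>

definition coupling_space :: "real measure \<Rightarrow> ((int \<Rightarrow> real) \<times> (int \<Rightarrow> real)) measure" where
  "coupling_space P = (\<Pi>\<^sub>M j\<in>(UNIV :: int set). P) \<Otimes>\<^sub>M (\<Pi>\<^sub>M j\<in>(UNIV :: int set). P)"

definition coupling_diff :: "((int \<Rightarrow> real) \<Rightarrow> real) \<Rightarrow> nat \<Rightarrow> (int \<Rightarrow> real) \<times> (int \<Rightarrow> real) \<Rightarrow> real" where
  "coupling_diff G k = (\<lambda>(u, v). G u - G (\<lambda>j. if \<bar>j\<bar> \<le> int k then u j else v j))"

definition condition_D :: "real measure \<Rightarrow> ((int \<Rightarrow> real) \<Rightarrow> real) \<Rightarrow> bool" where
  "condition_D P G \<longleftrightarrow>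
     (\<exists>q \<rho>. 0 < q \<and> 0 < \<rho> \<and> \<rho> < 1 \<and>
        (\<forall>\<^sub>F k in sequentially.
           integrable (coupling_space P) (\<lambda>z. \<bar>coupling_diff G k z\<bar> powr q)) \<and>
        (\<lambda>k. Lq_norm (coupling_space P) q (coupling_diff G k)) \<in> O(\<lambda>k. \<rho> ^ k))"

text \<open>
  A bounded density of the errors is what makes increments of the empirical process over windows
  of length \<open>\<delta>\<close> have variance of order \<open>\<delta>\<close>. Without it the rate below fails: for independent
  signs \<open>e\<^sub>i\<^sub>,\<^sub>j = \<plusminus>1\<close> the increment over an arbitrarily short window that contains an
  atom has variance of order \<open>\<phi>\<^sub>n\<close>.
\<close>

definition has_bounded_density :: "'a measure \<Rightarrow> ('a \<Rightarrow> real) \<Rightarrow> bool" where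
  "has_bounded_density M X \<longleftrightarrow>
     (\<exists>f B. distributed M lborel X (\<lambda>u. ennreal (f u)) \<and> (\<forall>u. 0 \<le> f u \<and> f u \<le> B))"

text \<open>
  In a sequence of designs, \<open>m n i\<close>, \<open>x n i j\<close> and \<open>w n i j\<close> are the sample size of subject
  \<open>i\<close>, the design points and the weight functions of the \<open>n\<close>-th design; it has the subjects
  \<open>i = 1, \<dots>, n\<close>.
\<close>

definition Nobs :: "(nat \<Rightarrow> nat \<Rightarrow> nat) \<Rightarrow> nat \<Rightarrow> nat" where
  "Nobs m n = (\<Sum>i=1..n. m n i)"

definition resp ::
  "(real \<Rightarrow> real) \<Rightarrow> (real \<Rightarrow> real) \<Rightarrow> (nat \<Rightarrow> nat \<Rightarrow> nat \<Rightarrow> real) \<Rightarrow> (int \<Rightarrow> int \<Rightarrow> 'a \<Rightarrow> real)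
    \<Rightarrow> nat \<Rightarrow> nat \<Rightarrow> nat \<Rightarrow> 'a \<Rightarrow> real" where
  "resp \<mu> s x e n i j \<omega> = \<mu> (x n i j) + s (x n i j) * e (int i) (int j) \<omega>"

definition Femp ::
  "(nat \<Rightarrow> nat \<Rightarrow> nat) \<Rightarrow> (nat \<Rightarrow> nat \<Rightarrow> nat \<Rightarrow> real \<Rightarrow> real) \<Rightarrow> (nat \<Rightarrow> nat \<Rightarrow> nat \<Rightarrow> 'a \<Rightarrow> real)
    \<Rightarrow> nat \<Rightarrow> real \<Rightarrow> real \<Rightarrow> 'a \<Rightarrow> real" where
  "Femp m w Y n t y \<omega> = (\<Sum>i=1..n. \<Sum>j=1..m n i. w n i j t * indicat_real {..y} (Y n i j \<omega>))"

definition Demp ::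
  "'a measure \<Rightarrow> (nat \<Rightarrow> nat \<Rightarrow> nat) \<Rightarrow> (nat \<Rightarrow> nat \<Rightarrow> nat \<Rightarrow> real \<Rightarrow> real)
    \<Rightarrow> (nat \<Rightarrow> nat \<Rightarrow> nat \<Rightarrow> 'a \<Rightarrow> real) \<Rightarrow> nat \<Rightarrow> real \<Rightarrow> real \<Rightarrow> real \<Rightarrow> 'a \<Rightarrow> real" where
  "Demp M m w Y n d t y \<omega> =
     (Femp m w Y n t (y + d) \<omega> - (\<integral>\<omega>'. Femp m w Y n t (y + d) \<omega>' \<partial>M)) -
     (Femp m w Y n t y \<omega> - (\<integral>\<omega>'. Femp m w Y n t y \<omega>' \<partial>M))"

text \<open>
  Measurability is part of the definition, because \<open>measure\<close> is \<open>0\<close> on nonmeasurable sets.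
\<close>

definition bigO_p :: "'a measure \<Rightarrow> (nat \<Rightarrow> 'a \<Rightarrow> real) \<Rightarrow> (nat \<Rightarrow> real) \<Rightarrow> bool" where
  "bigO_p M X a \<longleftrightarrow>
     (\<forall>n. X n \<in> borel_measurable M) \<and>
     (\<forall>\<eta>>0. \<exists>C>0. \<forall>\<^sub>F n in sequentially. measure M {\<omega> \<in> space M. \<bar>X n \<omega>\<bar> > C * a n} \<le> \<eta>)"

end

theory Submission
  imports Defs
begin

text \<open>
  By condition (D), the event $e_{i,j} \le v$ agrees, up to a probability that is geometrically
  small in $k$, with an event depending only on $\varepsilon_{i,j-k},\dots,\varepsilon_{i,j+k}$;
  here the bounded density absorbs the error in the threshold. With $k$ of order $\log N_n$ the
  truncated indicators agree with the original ones up to any negative power of $N_n$, and they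
  split into $2k+1$ classes of independent variables, one for each residue of $j$ modulo $2k+1$.
  Bernstein's inequality in each class gives deviations of order
  $(2k+1)(\delta_n\phi_n\log N_n)^{1/2}$ for a single increment with probability close to $1$.
  Polynomially many pairs of half-lines and points $x$ suffice to control the supremum up to a
  bounded error, which is of smaller order because $\log N_n = O(\delta_n\phi_n)$.
\<close>

section \<open>Bernstein's inequality\<close>

text \<open>Only the original errors are known to have a density; the truncated ones may have atoms.
  The grid, the sandwiching and the choice of neighbouring half-lines therefore use the laws of the
  original variables. The truncated variables occur only inside the tail bound for one pair, where
  their increment variance is compared with the original one. The union bound cannot run over all
  pairs of half-lines, because distant pairs have a large variance. It runs over the pairs whose
  laws differ by O(\<delta>), a nonrandom condition, and the end points of every window are shown to
  be bracketed by such pairs. The number of classes contributes one factor log N and Bernstein's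
  inequality its square root, which gives the power 3/2 of the rate. The parameter in Bernstein's
  inequality has to be of order sqrt(log N / (\<delta> \<phi>)); the supremum condition in (c) keeps
  it bounded, as bounded summands require.\<close>

lemma exp_le_quadratic:
  fixes x :: real
  assumes "\<bar>x\<bar> \<le> 1"
  shows "exp x \<le> 1 + x + x\<^sup>2"
proof (cases "x \<ge> 0")
  case True
  then show ?thesis using exp_bound[of x] assms by auto
next
  case False
  define y where "y = - x"
  have y: "0 < y" "y \<le> 1" using False assms by (auto simp: y_def)
  have "exp x = 1 / exp y" by (simp add: y_def exp_minus field_simps)
  also have "\<dots> \<le> 1 / (1 + y)"
    using y exp_ge_add_one_self[of y] by (intro divide_left_mono) auto
  also have "\<dots> \<le> 1 - y + y\<^sup>2"
  proof -
    have "(1 - y + y\<^sup>2) * (1 + y) = 1 + y ^ 3" by (simp add: algebra_simps power2_eq_square power3_eq_cube)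
    also have "\<dots> \<ge> 1" using y by simp
    finally show ?thesis using y by (simp add: field_simps)
  qed
  finally show ?thesis by (simp add: y_def)
qed

context prob_space
begin

lemma mgf_le_exp_second_moment:
  fixes X :: "'a \<Rightarrow> real"
  assumes [measurable]: "random_variable borel X"
    and bnd: "\<And>\<omega>. \<omega> \<in> space M \<Longrightarrow> \<bar>\<theta> * X \<omega>\<bar> \<le> 1"
    and mean: "expectation X = 0" and int: "integrable M X" "integrable M (\<lambda>\<omega>. (X \<omega>)\<^sup>2)"
  shows "expectation (\<lambda>\<omega>. exp (\<theta> * X \<omega>)) \<le> exp (\<theta>\<^sup>2 * expectation (\<lambda>\<omega>. (X \<omega>)\<^sup>2))"
proof -
  have "expectation (\<lambda>\<omega>. exp (\<theta> * X \<omega>)) \<le> expectation (\<lambda>\<omega>. 1 + \<theta> * X \<omega> + \<theta>\<^sup>2 * (X \<omega>)\<^sup>2)"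
  proof (rule integral_mono)
    show "integrable M (\<lambda>\<omega>. exp (\<theta> * X \<omega>))"
      using bnd by (intro integrable_const_bound[of _ "exp 1"]) (fastforce simp: abs_le_iff)+
    show "integrable M (\<lambda>\<omega>. 1 + \<theta> * X \<omega> + \<theta>\<^sup>2 * (X \<omega>)\<^sup>2)"
      using int by auto
    show "\<And>\<omega>. \<omega> \<in> space M \<Longrightarrow> exp (\<theta> * X \<omega>) \<le> 1 + \<theta> * X \<omega> + \<theta>\<^sup>2 * (X \<omega>)\<^sup>2"
      using exp_le_quadratic bnd by (metis power_mult_distrib)
  qed
  also have "\<dots> = 1 + \<theta>\<^sup>2 * expectation (\<lambda>\<omega>. (X \<omega>)\<^sup>2)"
    using int mean by (simp add: prob_space)
  also have "\<dots> \<le> exp (\<theta>\<^sup>2 * expectation (\<lambda>\<omega>. (X \<omega>)\<^sup>2))"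
    by (rule exp_ge_add_one_self)
  finally show ?thesis .
qed

text \<open>The parameter \<theta> stays free instead of being optimised, because its later choice
  must respect the constraint \<open>bnd\<close> and be the same for all classes of
  summands.\<close>

lemma bernstein_upper:
  fixes X :: "'i \<Rightarrow> 'a \<Rightarrow> real"
  assumes fin: "finite I" and ind: "indep_vars (\<lambda>_. borel) X I"
    and bnd: "\<And>i \<omega>. i \<in> I \<Longrightarrow> \<omega> \<in> space M \<Longrightarrow> \<bar>\<theta> * X i \<omega>\<bar> \<le> 1"
    and mean: "\<And>i. i \<in> I \<Longrightarrow> expectation (X i) = 0"
    and var: "(\<Sum>i\<in>I. expectation (\<lambda>\<omega>. (X i \<omega>)\<^sup>2)) \<le> V"
    and \<theta>: "0 < \<theta>"
  shows "prob {\<omega> \<in> space M. (\<Sum>i\<in>I. X i \<omega>) > a} \<le> exp (\<theta>\<^sup>2 * V - \<theta> * a)"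
proof -
  have [measurable]: "\<And>i. i \<in> I \<Longrightarrow> random_variable borel (X i)"
    using ind by (auto simp: indep_vars_def)
  have bnd': "\<bar>X i \<omega>\<bar> \<le> 1 / \<theta>" if "i \<in> I" "\<omega> \<in> space M" for i \<omega>
    using bnd[OF that] \<theta> by (simp add: abs_mult field_simps)
  have intX: "integrable M (X i)" if "i \<in> I" for i
    using that bnd' by (intro integrable_const_bound[of _ "1 / \<theta>"]) auto
  have intX2: "integrable M (\<lambda>\<omega>. (X i \<omega>)\<^sup>2)" if "i \<in> I" for i
    using that \<theta> bnd' by (intro integrable_const_bound[of _ "(1 / \<theta>)\<^sup>2"])
      (auto simp: abs_le_square_iff[symmetric] simp del: power_divide intro!: AE_I2)
  have inte: "integrable M (\<lambda>\<omega>. exp (\<theta> * X i \<omega>))" if "i \<in> I" for i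
    using that bnd by (intro integrable_const_bound[of _ "exp 1"]) (fastforce simp: abs_le_iff)+
  have indexp: "indep_vars (\<lambda>_. borel) (\<lambda>i \<omega>. exp (\<theta> * X i \<omega>)) I"
    using indep_vars_compose2[OF ind, of "\<lambda>_ x. exp (\<theta> * x)" "\<lambda>_. borel"] by simp
  let ?S = "\<lambda>\<omega>. \<Sum>i\<in>I. X i \<omega>"
  have eq: "exp (\<theta> * ?S \<omega>) = (\<Prod>i\<in>I. exp (\<theta> * X i \<omega>))" for \<omega>
    by (simp add: sum_distrib_left exp_sum[OF fin])
  have intS: "integrable M (\<lambda>\<omega>. exp (\<theta> * ?S \<omega>))"
    unfolding eq by (rule indep_vars_integrable[OF fin indexp inte])
  have "prob {\<omega> \<in> space M. ?S \<omega> > a} \<le> prob {\<omega> \<in> space M. exp (\<theta> * ?S \<omega>) \<ge> exp (\<theta> * a)}"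
    using \<theta> by (intro finite_measure_mono) auto
  also have "\<dots> \<le> expectation (\<lambda>\<omega>. exp (\<theta> * ?S \<omega>)) / exp (\<theta> * a)"
    using intS by (intro integral_Markov_inequality_measure[where A = "space M"]) auto
  also have "expectation (\<lambda>\<omega>. exp (\<theta> * ?S \<omega>)) = (\<Prod>i\<in>I. expectation (\<lambda>\<omega>. exp (\<theta> * X i \<omega>)))"
    unfolding eq by (rule indep_vars_lebesgue_integral[OF fin indexp inte])
  also have "\<dots> \<le> (\<Prod>i\<in>I. exp (\<theta>\<^sup>2 * expectation (\<lambda>\<omega>. (X i \<omega>)\<^sup>2)))"
    using bnd mean intX intX2 by (intro prod_mono conjI mgf_le_exp_second_moment) auto
  also have "\<dots> = exp (\<theta>\<^sup>2 * (\<Sum>i\<in>I. expectation (\<lambda>\<omega>. (X i \<omega>)\<^sup>2)))"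
    by (simp add: sum_distrib_left exp_sum[OF fin])
  also have "\<dots> \<le> exp (\<theta>\<^sup>2 * V)" using var by (simp add: mult_left_mono)
  finally show ?thesis by (simp add: exp_diff divide_right_mono)
qed

lemma bernstein_abs:
  fixes X :: "'i \<Rightarrow> 'a \<Rightarrow> real"
  assumes fin: "finite I" and ind: "indep_vars (\<lambda>_. borel) X I"
    and bnd: "\<And>i \<omega>. i \<in> I \<Longrightarrow> \<omega> \<in> space M \<Longrightarrow> \<bar>\<theta> * X i \<omega>\<bar> \<le> 1"
    and mean: "\<And>i. i \<in> I \<Longrightarrow> expectation (X i) = 0"
    and var: "(\<Sum>i\<in>I. expectation (\<lambda>\<omega>. (X i \<omega>)\<^sup>2)) \<le> V"
    and \<theta>: "0 < \<theta>"
  shows "prob {\<omega> \<in> space M. \<bar>\<Sum>i\<in>I. X i \<omega>\<bar> > a} \<le> 2 * exp (\<theta>\<^sup>2 * V - \<theta> * a)"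
proof -
  have [measurable]: "\<And>i. i \<in> I \<Longrightarrow> random_variable borel (X i)"
    using ind by (auto simp: indep_vars_def)
  have ind': "indep_vars (\<lambda>_. borel) (\<lambda>i \<omega>. - X i \<omega>) I"
    using indep_vars_compose2[OF ind, of "\<lambda>_ x. - x" "\<lambda>_. borel"] by simp
  have "prob {\<omega> \<in> space M. \<bar>\<Sum>i\<in>I. X i \<omega>\<bar> > a} \<le>
      prob ({\<omega> \<in> space M. (\<Sum>i\<in>I. X i \<omega>) > a} \<union> {\<omega> \<in> space M. (\<Sum>i\<in>I. - X i \<omega>) > a})"
    by (intro finite_measure_mono) (auto simp: sum_negf)
  also have "\<dots> \<le> prob {\<omega> \<in> space M. (\<Sum>i\<in>I. X i \<omega>) > a} + prob {\<omega> \<in> space M. (\<Sum>i\<in>I. - X i \<omega>) > a}"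
    by (intro measure_Un_le) auto
  also have "\<dots> \<le> exp (\<theta>\<^sup>2 * V - \<theta> * a) + exp (\<theta>\<^sup>2 * V - \<theta> * a)"
    using assms ind' by (intro add_mono bernstein_upper) auto
  finally show ?thesis by simp
qed

end

section \<open>Increments of the centred weighted empirical process\<close>

text \<open>Indexing by a set instead of a threshold lets the grid contain \<open>{}\<close> and
  \<open>UNIV\<close>, on which the process vanishes when \<open>M\<close> is a probability
  measure.\<close>

definition cemp :: "'a measure \<Rightarrow> 'i set \<Rightarrow> ('i \<Rightarrow> 'a \<Rightarrow> real) \<Rightarrow> ('i \<Rightarrow> real) \<Rightarrow> real set \<Rightarrow> 'a \<Rightarrow> real" where
  "cemp M I X v A \<omega> = (\<Sum>i\<in>I. v i * (indicat_real A (X i \<omega>) - measure M {\<omega>' \<in> space M. X i \<omega>' \<in> A}))"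

context prob_space
begin

lemma abs_prob_diff_le:
  assumes [measurable]: "Measurable.pred M P" "Measurable.pred M Q"
  shows "\<bar>prob {\<omega> \<in> space M. P \<omega>} - prob {\<omega> \<in> space M. Q \<omega>}\<bar> \<le> prob {\<omega> \<in> space M. P \<omega> \<noteq> Q \<omega>}"
proof -
  have "prob {\<omega> \<in> space M. P \<omega>} \<le> prob ({\<omega> \<in> space M. Q \<omega>} \<union> {\<omega> \<in> space M. P \<omega> \<noteq> Q \<omega>})"
    by (intro finite_measure_mono) auto
  also have "\<dots> \<le> prob {\<omega> \<in> space M. Q \<omega>} + prob {\<omega> \<in> space M. P \<omega> \<noteq> Q \<omega>}"
    by (intro measure_Un_le) auto
  finally have 1: "prob {\<omega> \<in> space M. P \<omega>} \<le> prob {\<omega> \<in> space M. Q \<omega>} + prob {\<omega> \<in> space M. P \<omega> \<noteq> Q \<omega>}" .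
  have "prob {\<omega> \<in> space M. Q \<omega>} \<le> prob ({\<omega> \<in> space M. P \<omega>} \<union> {\<omega> \<in> space M. P \<omega> \<noteq> Q \<omega>})"
    by (intro finite_measure_mono) auto
  also have "\<dots> \<le> prob {\<omega> \<in> space M. P \<omega>} + prob {\<omega> \<in> space M. P \<omega> \<noteq> Q \<omega>}"
    by (intro measure_Un_le) auto
  finally show ?thesis using 1 by linarith
qed

lemma prob_Un3_le:
  assumes [measurable]: "Measurable.pred M P1" "Measurable.pred M P2" "Measurable.pred M P3"
    and sub: "\<And>\<omega>. \<omega> \<in> space M \<Longrightarrow> P \<omega> \<Longrightarrow> P1 \<omega> \<or> P2 \<omega> \<or> P3 \<omega>"
  shows "prob {\<omega> \<in> space M. P \<omega>} \<le>
    prob {\<omega> \<in> space M. P1 \<omega>} + prob {\<omega> \<in> space M. P2 \<omega>} + prob {\<omega> \<in> space M. P3 \<omega>}"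
proof -
  have "prob {\<omega> \<in> space M. P \<omega>} \<le> prob ({\<omega> \<in> space M. P1 \<omega>} \<union> {\<omega> \<in> space M. P2 \<omega>} \<union> {\<omega> \<in> space M. P3 \<omega>})"
    using sub by (intro finite_measure_mono) auto
  also have "\<dots> \<le> prob ({\<omega> \<in> space M. P1 \<omega>} \<union> {\<omega> \<in> space M. P2 \<omega>}) + prob {\<omega> \<in> space M. P3 \<omega>}"
    by (intro measure_Un_le) auto
  also have "\<dots> \<le> prob {\<omega> \<in> space M. P1 \<omega>} + prob {\<omega> \<in> space M. P2 \<omega>} + prob {\<omega> \<in> space M. P3 \<omega>}"
    by (intro add_right_mono measure_Un_le) auto
  finally show ?thesis .
qed

text \<open>If the total exceeds \<open>R * a\<close>, then one of the \<open>R\<close> class sums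
  exceeds \<open>a\<close>. Each class is granted the whole variance budget \<open>V\<close>, so the
  price of dependence is the factor \<open>R\<close> in the threshold; this is where the additional
  logarithm comes from.\<close>

lemma bernstein_coloured:
  fixes X :: "'i \<Rightarrow> 'a \<Rightarrow> real" and col :: "'i \<Rightarrow> nat"
  assumes fin: "finite I" and col: "\<And>i. i \<in> I \<Longrightarrow> col i < R"
    and ind: "\<And>r. r < R \<Longrightarrow> indep_vars (\<lambda>_. borel) X {i \<in> I. col i = r}"
    and bnd: "\<And>i \<omega>. i \<in> I \<Longrightarrow> \<omega> \<in> space M \<Longrightarrow> \<bar>\<theta> * X i \<omega>\<bar> \<le> 1"
    and mean: "\<And>i. i \<in> I \<Longrightarrow> expectation (X i) = 0"
    and var: "(\<Sum>i\<in>I. expectation (\<lambda>\<omega>. (X i \<omega>)\<^sup>2)) \<le> V"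
    and \<theta>: "0 < \<theta>"
  shows "prob {\<omega> \<in> space M. \<bar>\<Sum>i\<in>I. X i \<omega>\<bar> > real R * a} \<le> 2 * real R * exp (\<theta>\<^sup>2 * V - \<theta> * a)"
proof -
  have [measurable]: "random_variable borel (X i)" if "i \<in> I" for i
    using ind[OF col[OF that]] that by (auto simp: indep_vars_def)
  define J where "J r = {i \<in> I. col i = r}" for r
  have J: "finite (J r)" "J r \<subseteq> I" for r using fin by (auto simp: J_def)
  have [measurable]: "(\<lambda>\<omega>. \<Sum>i\<in>J r. X i \<omega>) \<in> borel_measurable M" for r
    using J(2) by (intro borel_measurable_sum) (meson \<open>\<And>i. i \<in> I \<Longrightarrow> random_variable borel (X i)\<close> subsetD)
  have S: "(\<Sum>i\<in>I. X i \<omega>) = (\<Sum>r<R. \<Sum>i\<in>J r. X i \<omega>)" for \<omega>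
    unfolding J_def using sum.group[of I "{..<R}" col "\<lambda>i. X i \<omega>"] fin col by force
  have "\<exists>r<R. \<bar>\<Sum>i\<in>J r. X i \<omega>\<bar> > a" if "\<bar>\<Sum>i\<in>I. X i \<omega>\<bar> > real R * a" for \<omega>
  proof (rule ccontr)
    assume "\<not> ?thesis"
    then have "\<And>r. r < R \<Longrightarrow> \<bar>\<Sum>i\<in>J r. X i \<omega>\<bar> \<le> a" by (meson not_le)
    then have "(\<Sum>r<R. \<bar>\<Sum>i\<in>J r. X i \<omega>\<bar>) \<le> (\<Sum>r<R. a)" by (intro sum_mono) auto
    moreover have "\<bar>\<Sum>i\<in>I. X i \<omega>\<bar> \<le> (\<Sum>r<R. \<bar>\<Sum>i\<in>J r. X i \<omega>\<bar>)" unfolding S by (rule sum_abs)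
    ultimately show False using that by simp
  qed
  then have "prob {\<omega> \<in> space M. \<bar>\<Sum>i\<in>I. X i \<omega>\<bar> > real R * a} \<le>
      prob (\<Union>r\<in>{..<R}. {\<omega> \<in> space M. \<bar>\<Sum>i\<in>J r. X i \<omega>\<bar> > a})"
    by (intro finite_measure_mono) (fastforce, measurable)
  also have "\<dots> \<le> (\<Sum>r<R. prob {\<omega> \<in> space M. \<bar>\<Sum>i\<in>J r. X i \<omega>\<bar> > a})"
    by (intro finite_measure_subadditive_finite) auto
  also have "\<dots> \<le> (\<Sum>r<R. 2 * exp (\<theta>\<^sup>2 * V - \<theta> * a))"
  proof (intro sum_mono bernstein_abs)
    fix r assume r: "r \<in> {..<R}"
    show "indep_vars (\<lambda>_. borel) X (J r)" using ind r by (auto simp: J_def)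
    have "(\<Sum>i\<in>J r. expectation (\<lambda>\<omega>. (X i \<omega>)\<^sup>2)) \<le> (\<Sum>i\<in>I. expectation (\<lambda>\<omega>. (X i \<omega>)\<^sup>2))"
      using J fin by (intro sum_mono2) auto
    then show "(\<Sum>i\<in>J r. expectation (\<lambda>\<omega>. (X i \<omega>)\<^sup>2)) \<le> V" using var by simp
  qed (use J(1) subsetD[OF J(2)] bnd mean \<theta> in blast)+
  finally show ?thesis by simp
qed

lemma abs_indicator_diff_le: "\<bar>indicat_real A x - indicat_real B y\<bar> \<le> 1"
  by (auto simp: indicator_def)

text \<open>Bernstein's inequality is applied to the independent classes of \<open>Xt\<close>. If
  all indicators of \<open>X\<close> and \<open>Xt\<close> agree on both sets, the only remaining
  difference is that of the means, at most \<kappa> per observation and set, hence the shift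
  \<open>2 * c * card I * \<kappa>\<close>. The hypothesis on \<beta> concerns \<open>X\<close>,
  since only its law is under control; the passage to \<open>Xt\<close> enlarges the variance by
  2\<kappa>.\<close>

lemma cemp_diff_tail:
  fixes X Xt :: "'i \<Rightarrow> 'a \<Rightarrow> real" and col :: "'i \<Rightarrow> nat"
  assumes fin: "finite I" and col: "\<And>i. i \<in> I \<Longrightarrow> col i < R"
    and X[measurable]: "\<And>i. i \<in> I \<Longrightarrow> random_variable borel (X i)"
    and ind: "\<And>r. r < R \<Longrightarrow> indep_vars (\<lambda>_. borel) Xt {i \<in> I. col i = r}"
    and A[measurable]: "A \<in> sets borel" "A' \<in> sets borel"
    and \<kappa>: "\<And>i. i \<in> I \<Longrightarrow> prob {\<omega> \<in> space M. (X i \<omega> \<in> A) \<noteq> (Xt i \<omega> \<in> A)} \<le> \<kappa>"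
      "\<And>i. i \<in> I \<Longrightarrow> prob {\<omega> \<in> space M. (X i \<omega> \<in> A') \<noteq> (Xt i \<omega> \<in> A')} \<le> \<kappa>"
    and \<beta>: "\<And>i. i \<in> I \<Longrightarrow> prob {\<omega> \<in> space M. (X i \<omega> \<in> A) \<noteq> (X i \<omega> \<in> A')} \<le> \<beta>"
    and v: "\<And>i. i \<in> I \<Longrightarrow> 0 \<le> v i \<and> v i \<le> c" and \<phi>: "(\<Sum>i\<in>I. (v i)\<^sup>2) \<le> \<phi>"
    and \<theta>: "0 < \<theta>" "2 * c * \<theta> \<le> 1" and nonneg: "0 \<le> \<beta> + 2 * \<kappa>"
  shows "prob {\<omega> \<in> space M. \<bar>cemp M I X v A \<omega> - cemp M I X v A' \<omega>\<bar> > real R * a + 2 * c * real (card I) * \<kappa>}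
     \<le> 2 * real R * exp (\<theta>\<^sup>2 * (\<phi> * (\<beta> + 2 * \<kappa>)) - \<theta> * a) + 2 * real (card I) * \<kappa>"
proof -
  have Xt[measurable]: "random_variable borel (Xt i)" if "i \<in> I" for i
    using ind[OF col[OF that]] that by (auto simp: indep_vars_def)
  define p where "p i B = prob {\<omega> \<in> space M. X i \<omega> \<in> B}" for i B
  define pt where "pt i B = prob {\<omega> \<in> space M. Xt i \<omega> \<in> B}" for i B
  \<comment> \<open>Centring with the law of \<open>Xt\<close>, not that of \<open>X\<close>, makes
    the mean exactly zero.\<close>
  define f where "f i y = v i * (indicat_real A y - indicat_real A' y - (pt i A - pt i A'))" for i and y :: real
  have [measurable]: "f i \<in> borel_measurable borel" for i unfolding f_def by measurable
  have pt: "\<bar>pt i A - pt i A'\<bar> \<le> 1" for i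
    unfolding pt_def by (smt (verit) measure_nonneg prob_le_1)
  have fb: "\<bar>f i y\<bar> \<le> 2 * c" if "i \<in> I" for i y
  proof -
    have "\<bar>f i y\<bar> = v i * \<bar>indicat_real A y - indicat_real A' y - (pt i A - pt i A')\<bar>"
      using v[OF that] by (simp add: f_def abs_mult)
    also have "\<dots> \<le> c * 2"
      using v[OF that] pt[of i] abs_indicator_diff_le[of A y A' y] by (intro mult_mono) linarith+
    finally show ?thesis by simp
  qed
  have indf: "indep_vars (\<lambda>_. borel) (\<lambda>i \<omega>. f i (Xt i \<omega>)) {i \<in> I. col i = r}" if "r < R" for r
    by (rule indep_vars_compose2[OF ind[OF that]]) measurable
  have expind: "integrable M (\<lambda>\<omega>. indicat_real B (Xt i \<omega>))"
      "expectation (\<lambda>\<omega>. indicat_real B (Xt i \<omega>)) = pt i B"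
    if [simp, measurable]: "i \<in> I" "B \<in> sets borel" for i and B :: "real set"
  proof -
    show "integrable M (\<lambda>\<omega>. indicat_real B (Xt i \<omega>))"
      by (intro integrable_const_bound[of _ 1]) (auto simp: indicator_def)
    have "expectation (\<lambda>\<omega>. indicat_real B (Xt i \<omega>)) = expectation (indicat_real {\<omega> \<in> space M. Xt i \<omega> \<in> B})"
      by (intro Bochner_Integration.integral_cong) (auto simp: indicator_def)
    then show "expectation (\<lambda>\<omega>. indicat_real B (Xt i \<omega>)) = pt i B"
      by (simp add: pt_def)
  qed
  have mean: "expectation (\<lambda>\<omega>. f i (Xt i \<omega>)) = 0" if "i \<in> I" for i
    using expind[OF that] A by (simp add: f_def prob_space)
  \<comment> \<open>Centring only lowers the second moment, and the squared difference of two
    indicators is the indicator of their disagreement. Replacing \<open>Xt\<close> by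
    \<open>X\<close> in that event costs \<kappa> for each of the two sets.\<close>
  have var: "expectation (\<lambda>\<omega>. (f i (Xt i \<omega>))\<^sup>2) \<le> (v i)\<^sup>2 * (\<beta> + 2 * \<kappa>)" if i[measurable]: "i \<in> I" for i
  proof -
    let ?g = "\<lambda>\<omega>. indicat_real A (Xt i \<omega>) - indicat_real A' (Xt i \<omega>)"
    have g2: "(?g \<omega>)\<^sup>2 = indicat_real {\<omega> \<in> space M. (Xt i \<omega> \<in> A) \<noteq> (Xt i \<omega> \<in> A')} \<omega>" if "\<omega> \<in> space M" for \<omega>
      using that by (auto simp: indicator_def)
    have eg: "expectation ?g = pt i A - pt i A'" using expind[OF i] A by simp
    have "expectation (\<lambda>\<omega>. (f i (Xt i \<omega>))\<^sup>2) = (v i)\<^sup>2 * expectation (\<lambda>\<omega>. (?g \<omega> - expectation ?g)\<^sup>2)"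
      unfolding eg f_def by (simp add: power_mult_distrib)
    also have "\<dots> \<le> (v i)\<^sup>2 * expectation (\<lambda>\<omega>. (?g \<omega>)\<^sup>2)"
    proof (intro mult_left_mono)
      have "integrable M (\<lambda>\<omega>. (?g \<omega>)\<^sup>2)"
        by (intro integrable_const_bound[of _ 1]) (auto simp: indicator_def)
      moreover have "integrable M ?g" using expind[OF i] A by simp
      ultimately show "expectation (\<lambda>\<omega>. (?g \<omega> - expectation ?g)\<^sup>2) \<le> expectation (\<lambda>\<omega>. (?g \<omega>)\<^sup>2)"
        by (subst variance_eq) auto
    qed simp
    also have "expectation (\<lambda>\<omega>. (?g \<omega>)\<^sup>2) = prob {\<omega> \<in> space M. (Xt i \<omega> \<in> A) \<noteq> (Xt i \<omega> \<in> A')}"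
      using g2 by (subst Bochner_Integration.integral_cong[OF refl g2]) auto
    also have "\<dots> \<le> prob {\<omega> \<in> space M. (X i \<omega> \<in> A) \<noteq> (Xt i \<omega> \<in> A)} + prob {\<omega> \<in> space M. (X i \<omega> \<in> A') \<noteq> (Xt i \<omega> \<in> A')}
        + prob {\<omega> \<in> space M. (X i \<omega> \<in> A) \<noteq> (X i \<omega> \<in> A')}"
      by (intro prob_Un3_le) auto
    also have "\<dots> \<le> \<beta> + 2 * \<kappa>" using \<kappa>(1)[OF i] \<kappa>(2)[OF i] \<beta>[OF i] by linarith
    finally show ?thesis by (simp add: mult_left_mono)
  qed
  have "(\<Sum>i\<in>I. expectation (\<lambda>\<omega>. (f i (Xt i \<omega>))\<^sup>2)) \<le> (\<Sum>i\<in>I. (v i)\<^sup>2 * (\<beta> + 2 * \<kappa>))"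
    by (intro sum_mono var)
  also have "\<dots> = (\<Sum>i\<in>I. (v i)\<^sup>2) * (\<beta> + 2 * \<kappa>)" by (simp add: sum_distrib_right)
  also have "\<dots> \<le> \<phi> * (\<beta> + 2 * \<kappa>)" using \<phi> nonneg by (rule mult_right_mono)
  finally have varS: "(\<Sum>i\<in>I. expectation (\<lambda>\<omega>. (f i (Xt i \<omega>))\<^sup>2)) \<le> \<phi> * (\<beta> + 2 * \<kappa>)" .
  have fb': "\<bar>\<theta> * f i y\<bar> \<le> 1" if "i \<in> I" for i y
  proof -
    have "\<theta> * \<bar>f i y\<bar> \<le> \<theta> * (2 * c)" using fb[OF that] \<theta> by (intro mult_left_mono) auto
    also have "\<dots> \<le> 1" using \<theta>(2) by (simp add: mult.commute mult.left_commute)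
    finally show ?thesis using \<theta>(1) by (simp add: abs_mult)
  qed
  have main: "prob {\<omega> \<in> space M. \<bar>\<Sum>i\<in>I. f i (Xt i \<omega>)\<bar> > real R * a}
      \<le> 2 * real R * exp (\<theta>\<^sup>2 * (\<phi> * (\<beta> + 2 * \<kappa>)) - \<theta> * a)"
    by (rule bernstein_coloured[OF fin col indf fb' mean varS \<theta>(1)])
  have union: "prob {\<omega> \<in> space M. \<exists>i\<in>I. (X i \<omega> \<in> B) \<noteq> (Xt i \<omega> \<in> B)} \<le> real (card I) * \<kappa>"
    if [measurable]: "B \<in> sets borel" and B: "\<And>i. i \<in> I \<Longrightarrow> prob {\<omega> \<in> space M. (X i \<omega> \<in> B) \<noteq> (Xt i \<omega> \<in> B)} \<le> \<kappa>" for B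
  proof -
    have "prob {\<omega> \<in> space M. \<exists>i\<in>I. (X i \<omega> \<in> B) \<noteq> (Xt i \<omega> \<in> B)}
        = prob (\<Union>i\<in>I. {\<omega> \<in> space M. (X i \<omega> \<in> B) \<noteq> (Xt i \<omega> \<in> B)})"
      by (intro arg_cong[of _ _ prob]) auto
    also have "\<dots> \<le> (\<Sum>i\<in>I. prob {\<omega> \<in> space M. (X i \<omega> \<in> B) \<noteq> (Xt i \<omega> \<in> B)})"
      using fin by (intro finite_measure_subadditive_finite) auto
    also have "\<dots> \<le> (\<Sum>i\<in>I. \<kappa>)" by (intro sum_mono B)
    finally show ?thesis by simp
  qed
  have bias: "\<bar>p i B - pt i B\<bar> \<le> \<kappa>" if [measurable]: "i \<in> I" "B \<in> sets borel"
    and "prob {\<omega> \<in> space M. (X i \<omega> \<in> B) \<noteq> (Xt i \<omega> \<in> B)} \<le> \<kappa>" for i B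
    unfolding p_def pt_def using that(3) by (intro order_trans[OF abs_prob_diff_le]) auto
  have "prob {\<omega> \<in> space M. \<bar>cemp M I X v A \<omega> - cemp M I X v A' \<omega>\<bar> > real R * a + 2 * c * real (card I) * \<kappa>}
     \<le> prob {\<omega> \<in> space M. \<bar>\<Sum>i\<in>I. f i (Xt i \<omega>)\<bar> > real R * a}
       + prob {\<omega> \<in> space M. \<exists>i\<in>I. (X i \<omega> \<in> A) \<noteq> (Xt i \<omega> \<in> A)}
       + prob {\<omega> \<in> space M. \<exists>i\<in>I. (X i \<omega> \<in> A') \<noteq> (Xt i \<omega> \<in> A')}"
  proof (rule prob_Un3_le)
    show "Measurable.pred M (\<lambda>\<omega>. \<bar>\<Sum>i\<in>I. f i (Xt i \<omega>)\<bar> > real R * a)" by measurable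
    show "Measurable.pred M (\<lambda>\<omega>. \<exists>i\<in>I. (X i \<omega> \<in> A) \<noteq> (Xt i \<omega> \<in> A))"
      "Measurable.pred M (\<lambda>\<omega>. \<exists>i\<in>I. (X i \<omega> \<in> A') \<noteq> (Xt i \<omega> \<in> A'))"
      using fin by (auto intro!: pred_intros_finite)
    fix \<omega> assume \<omega>: "\<omega> \<in> space M"
      "\<bar>cemp M I X v A \<omega> - cemp M I X v A' \<omega>\<bar> > real R * a + 2 * c * real (card I) * \<kappa>"
    show "\<bar>\<Sum>i\<in>I. f i (Xt i \<omega>)\<bar> > real R * a \<or> (\<exists>i\<in>I. (X i \<omega> \<in> A) \<noteq> (Xt i \<omega> \<in> A)) \<or> (\<exists>i\<in>I. (X i \<omega> \<in> A') \<noteq> (Xt i \<omega> \<in> A'))"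
    proof (rule ccontr)
      assume neg: "\<not> ?thesis"
      have "cemp M I X v A \<omega> - cemp M I X v A' \<omega> =
        (\<Sum>i\<in>I. f i (Xt i \<omega>) + v i * ((pt i A - p i A) - (pt i A' - p i A')))"
        unfolding cemp_def sum_subtractf[symmetric]
        by (intro sum.cong refl) (use neg in \<open>auto simp: f_def p_def indicator_def algebra_simps\<close>)
      also have "\<dots> = (\<Sum>i\<in>I. f i (Xt i \<omega>)) + (\<Sum>i\<in>I. v i * ((pt i A - p i A) - (pt i A' - p i A')))"
        by (rule sum.distrib)
      finally have eq: "cemp M I X v A \<omega> - cemp M I X v A' \<omega> = \<dots>" .
      have "\<bar>\<Sum>i\<in>I. v i * ((pt i A - p i A) - (pt i A' - p i A'))\<bar> \<le> (\<Sum>i\<in>I. c * (2 * \<kappa>))"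
      proof (intro order_trans[OF sum_abs] sum_mono)
        fix i assume i: "i \<in> I"
        have "\<bar>(pt i A - p i A) - (pt i A' - p i A')\<bar> \<le> 2 * \<kappa>"
          using bias[OF i A(1) \<kappa>(1)[OF i]] bias[OF i A(2) \<kappa>(2)[OF i]] by linarith
        then show "\<bar>v i * ((pt i A - p i A) - (pt i A' - p i A'))\<bar> \<le> c * (2 * \<kappa>)"
          unfolding abs_mult using v[OF i] by (intro mult_mono) auto
      qed
      also have "\<dots> = 2 * c * real (card I) * \<kappa>" by simp
      finally show False using \<omega>(2) neg unfolding eq by linarith
    qed
  qed
  also have "\<dots> \<le> 2 * real R * exp (\<theta>\<^sup>2 * (\<phi> * (\<beta> + 2 * \<kappa>)) - \<theta> * a) + real (card I) * \<kappa> + real (card I) * \<kappa>"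
    using main union[OF A(1) \<kappa>(1)] union[OF A(2) \<kappa>(2)] by linarith
  finally show ?thesis by (simp add: algebra_simps)
qed

end

section \<open>Approximation by finitely many innovations\<close>

lemma prob_space_PiM_const: "prob_space P \<Longrightarrow> prob_space (\<Pi>\<^sub>M j\<in>I. P)"
  by (intro prob_space_PiM) auto

lemma splice_measurable:
  fixes v :: "'i \<Rightarrow> real"
  shows "(\<lambda>u j. if j \<in> K then u j else v j) \<in> measurable (\<Pi>\<^sub>M j\<in>K. borel) (\<Pi>\<^sub>M j\<in>UNIV. borel)"
proof (rule measurable_PiM_single')
  show "(\<lambda>u. if j \<in> K then u j else v j) \<in> borel_measurable (\<Pi>\<^sub>M j\<in>K. borel)" for j
    by (cases "j \<in> K") simp_all
qed (simp add: space_PiM)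

text \<open>Markov's inequality for the power q at level \<rho>^(k/2): half of the exponent is spent
  on the threshold, and the other half leaves the probability bound \<rho>^(qk/2).\<close>

lemma coupling_tail:
  fixes G :: "(int \<Rightarrow> real) \<Rightarrow> real"
  assumes D: "condition_D P G" and P: "prob_space P" "sets P = sets borel"
    and G: "G \<in> borel_measurable (\<Pi>\<^sub>M k\<in>(UNIV :: int set). borel)"
  shows "\<exists>C r. 0 < C \<and> 0 < r \<and> r < 1 \<and>
    (\<forall>\<^sub>F k in sequentially. measure (coupling_space P) {z \<in> space (coupling_space P). \<bar>coupling_diff G k z\<bar> > r ^ k} \<le> C * r ^ k)"
proof -
  obtain q \<rho> where q: "0 < q" and \<rho>: "0 < \<rho>" "\<rho> < 1"
    and int: "\<forall>\<^sub>F k in sequentially. integrable (coupling_space P) (\<lambda>z. \<bar>coupling_diff G k z\<bar> powr q)"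
    and O: "(\<lambda>k. Lq_norm (coupling_space P) q (coupling_diff G k)) \<in> O(\<lambda>k. \<rho> ^ k)"
    using D by (auto simp: condition_D_def)
  obtain C where C: "C > 0"
    and Cb: "\<forall>\<^sub>F k in sequentially. norm (Lq_norm (coupling_space P) q (coupling_diff G k)) \<le> C * norm (\<rho> ^ k)"
    using landau_o.bigE[OF O] by blast
  \<comment> \<open>The maximum lets one rate bound both the threshold \<rho>^(k/2) and the
    probability \<rho>^(qk/2).\<close>
  define r where "r = max (\<rho> powr (q / 2)) (\<rho> powr (1 / 2))"
  have r: "0 < r" "r < 1" using \<rho> q powr01_less_one[OF \<rho>] by (auto simp: r_def less_max_iff_disj)
  let ?S = "coupling_space P"
  have "\<forall>\<^sub>F k in sequentially. measure ?S {z \<in> space ?S. \<bar>coupling_diff G k z\<bar> > r ^ k} \<le> C powr q * r ^ k"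
    using int Cb
  proof eventually_elim
    case (elim k)
    let ?f = "\<lambda>z. \<bar>coupling_diff G k z\<bar> powr q"
    let ?\<eta> = "\<rho> powr (real k / 2)"
    have \<eta>: "?\<eta> > 0" using \<rho> by simp
    have eta_le: "?\<eta> \<le> r ^ k"
    proof -
      have "?\<eta> = (\<rho> powr (1 / 2)) ^ k" using \<rho> by (simp add: powr_realpow[symmetric] powr_powr)
      also have "\<dots> \<le> r ^ k" by (intro power_mono) (auto simp: r_def)
      finally show ?thesis .
    qed
    have I0: "0 \<le> (\<integral>z. ?f z \<partial>?S)" by (intro integral_nonneg_AE) auto
    have Lk: "(\<integral>z. ?f z \<partial>?S) powr (1 / q) \<le> C * \<rho> ^ k"
      using elim(2) \<rho> by (simp add: Lq_norm_def)
    have Iq: "(\<integral>z. ?f z \<partial>?S) \<le> C powr q * \<rho> powr (q * real k)"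
    proof -
      have "(\<integral>z. ?f z \<partial>?S) = ((\<integral>z. ?f z \<partial>?S) powr (1 / q)) powr q"
        using q I0 by (simp add: powr_powr)
      also have "\<dots> \<le> (C * \<rho> ^ k) powr q" using Lk q by (intro powr_mono2) auto
      also have "\<dots> = C powr q * \<rho> powr (q * real k)"
        using C \<rho> by (simp add: powr_mult powr_realpow[symmetric] powr_powr mult.commute)
      finally show ?thesis .
    qed
    interpret Q: prob_space "\<Pi>\<^sub>M j\<in>(UNIV :: int set). P" by (rule prob_space_PiM_const[OF P(1)])
    interpret QQ: pair_prob_space "\<Pi>\<^sub>M j\<in>(UNIV :: int set). P" "\<Pi>\<^sub>M j\<in>(UNIV :: int set). P" ..
    interpret S: prob_space ?S unfolding coupling_space_def by (rule QQ.prob_space_axioms)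
    have sub: "{z \<in> space ?S. \<bar>coupling_diff G k z\<bar> > r ^ k} \<subseteq> {z \<in> space ?S. ?f z \<ge> ?\<eta> powr q}"
      using q eta_le \<eta> by (auto intro!: powr_mono2)
    have fm: "?f \<in> borel_measurable ?S" using elim(1) by auto
    have "measure ?S {z \<in> space ?S. \<bar>coupling_diff G k z\<bar> > r ^ k} \<le> measure ?S {z \<in> space ?S. ?f z \<ge> ?\<eta> powr q}"
      using fm by (intro S.finite_measure_mono sub) auto
    also have "\<dots> \<le> (\<integral>z. ?f z \<partial>?S) / ?\<eta> powr q"
      using elim(1) \<eta> by (intro integral_Markov_inequality_measure[where A = "space ?S"]) auto
    also have "\<dots> \<le> C powr q * \<rho> powr (q * real k) / ?\<eta> powr q"
      using Iq by (intro divide_right_mono) auto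
    also have "\<dots> = C powr q * (\<rho> powr (q / 2)) ^ k"
    proof -
      have "\<rho> powr (q * real k) / ?\<eta> powr q = \<rho> powr (q / 2 * real k)"
        using \<rho> by (simp add: powr_powr powr_diff[symmetric])
      also have "\<dots> = (\<rho> powr (q / 2)) ^ k" using \<rho> by (simp add: powr_realpow[symmetric] powr_powr)
      finally show ?thesis by (metis times_divide_eq_right)
    qed
    also have "\<dots> \<le> C powr q * r ^ k"
      by (intro mult_left_mono power_mono) (auto simp: r_def)
    finally show ?case .
  qed
  then show ?thesis using C r by (intro exI[of _ "C powr q"] exI[of _ r]) auto
qed

text \<open>If every section had mass above \<open>2 * b\<close>, Tonelli's theorem would give the
  product set mass at least \<open>2 * b\<close>. The factor 2 leaves a strict gap, so that
  non-strict integral inequalities suffice.\<close>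

lemma pair_measure_section_le:
  assumes A: "A \<in> sets (M1 \<Otimes>\<^sub>M M2)" and "prob_space M1" "prob_space M2"
    and le: "measure (M1 \<Otimes>\<^sub>M M2) A \<le> b" and b: "0 < b"
  shows "\<exists>y\<in>space M2. measure M1 ((\<lambda>x. (x, y)) -` A) \<le> 2 * b"
proof (rule ccontr)
  interpret M1: prob_space M1 by fact
  interpret M2: prob_space M2 by fact
  interpret MM: pair_prob_space M1 M2 ..
  assume "\<not> ?thesis"
  then have gt: "measure M1 ((\<lambda>x. (x, y)) -` A) > 2 * b" if "y \<in> space M2" for y using that by auto
  have "ennreal (2 * b) = (\<integral>\<^sup>+y. ennreal (2 * b) \<partial>M2)" by (simp add: M2.emeasure_space_1)
  also have "\<dots> \<le> (\<integral>\<^sup>+y. emeasure M1 ((\<lambda>x. (x, y)) -` A) \<partial>M2)"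
    using gt by (intro nn_integral_mono) (auto simp: M1.emeasure_eq_measure less_imp_le intro!: ennreal_leI)
  also have "\<dots> = emeasure (M1 \<Otimes>\<^sub>M M2) A" by (rule MM.emeasure_pair_measure_alt2[OF A, symmetric])
  also have "\<dots> \<le> ennreal b" using le by (simp add: MM.emeasure_eq_measure ennreal_leI)
  finally show False using b by simp
qed

text \<open>
  The independent copy is replaced by a fixed realisation of it, chosen by Fubini's theorem, so
  that the approximation is a function of finitely many innovations on the original space.
\<close>

lemma finite_range_approx:
  fixes G :: "(int \<Rightarrow> real) \<Rightarrow> real"
  assumes D: "condition_D P G" and P: "prob_space P" "sets P = sets borel"
    and G[measurable]: "G \<in> borel_measurable (\<Pi>\<^sub>M k\<in>(UNIV :: int set). borel)"
  shows "\<exists>C r. 0 < C \<and> 0 < r \<and> r < 1 \<and>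
    (\<forall>\<^sub>F k in sequentially. \<exists>g\<in>borel_measurable (\<Pi>\<^sub>M l\<in>{- int k..int k}. borel).
       measure (\<Pi>\<^sub>M j\<in>UNIV. P) {u. \<bar>G u - g (restrict u {- int k..int k})\<bar> > r ^ k} \<le> C * r ^ k)"
proof -
  obtain C r where C: "0 < C" and r: "0 < r" "r < 1"
    and ev: "\<forall>\<^sub>F k in sequentially. measure (coupling_space P) {z \<in> space (coupling_space P). \<bar>coupling_diff G k z\<bar> > r ^ k} \<le> C * r ^ k"
    using coupling_tail[OF assms] by auto
  let ?Q = "\<Pi>\<^sub>M j\<in>(UNIV :: int set). P"
  have spP: "space P = UNIV" using P(2) sets_eq_imp_space_eq by fastforce
  have setsQ: "sets ?Q = sets (\<Pi>\<^sub>M j\<in>(UNIV :: int set). borel)" by (intro sets_PiM_cong) (auto simp: P)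
  have spQ: "space ?Q = UNIV" by (simp add: space_PiM spP)
  have GQ: "G \<in> borel_measurable ?Q" by (subst measurable_cong_sets[OF setsQ refl]) (rule G)
  interpret Q: prob_space ?Q by (rule prob_space_PiM_const[OF P(1)])
  have "\<forall>\<^sub>F k in sequentially. \<exists>g\<in>borel_measurable (\<Pi>\<^sub>M l\<in>{- int k..int k}. borel).
       measure ?Q {u. \<bar>G u - g (restrict u {- int k..int k})\<bar> > r ^ k} \<le> 2 * C * r ^ k"
    using ev
  proof eventually_elim
    case (elim k)
    have m: "(\<lambda>(u, v) j. if \<bar>j\<bar> \<le> int k then u j else v j) \<in> measurable (?Q \<Otimes>\<^sub>M ?Q) (\<Pi>\<^sub>M j\<in>(UNIV :: int set). borel)"
      apply (rule measurable_PiM_single')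
       apply (simp_all add: case_prod_beta space_pair_measure spQ)
      subgoal for j
        using P(2)
        by (intro measurable_If)
          (auto intro!: measurable_compose[OF measurable_fst] measurable_compose[OF measurable_snd]
            simp: measurable_cong_sets[OF refl P(2), symmetric])
      done
    have "coupling_diff G k = (\<lambda>z. G (fst z) - G ((\<lambda>(u, v) j. if \<bar>j\<bar> \<le> int k then u j else v j) z))"
      by (auto simp: coupling_diff_def)
    then have mG: "coupling_diff G k \<in> borel_measurable (?Q \<Otimes>\<^sub>M ?Q)"
      by (simp only:) (intro borel_measurable_diff measurable_compose[OF measurable_fst GQ] measurable_compose[OF m G])
    define A where "A = {z \<in> space (?Q \<Otimes>\<^sub>M ?Q). \<bar>coupling_diff G k z\<bar> > r ^ k}"
    have A: "A \<in> sets (?Q \<Otimes>\<^sub>M ?Q)" using mG unfolding A_def by simp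
    obtain v where v: "measure ?Q ((\<lambda>x. (x, v)) -` A) \<le> 2 * (C * r ^ k)"
      using pair_measure_section_le[OF A Q.prob_space_axioms Q.prob_space_axioms, of "C * r ^ k"] elim C r
      unfolding coupling_space_def A_def by (auto simp: mult_pos_pos)
    define g where "g = (\<lambda>u. G (\<lambda>j. if j \<in> {- int k..int k} then u j else v j))"
    have "g \<in> borel_measurable (\<Pi>\<^sub>M l\<in>{- int k..int k}. borel)"
      unfolding g_def by (rule measurable_compose[OF splice_measurable G])
    moreover have "(\<lambda>x. (x, v)) -` A = {u. \<bar>G u - g (restrict u {- int k..int k})\<bar> > r ^ k}"
    proof -
      have "(\<lambda>j. if \<bar>j\<bar> \<le> int k then u j else v j) =
        (\<lambda>j. if j \<in> {- int k..int k} then restrict u {- int k..int k} j else v j)" for u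
        by (rule ext) (auto simp: abs_le_iff)
      then show ?thesis
        by (auto simp: A_def g_def coupling_diff_def space_pair_measure spQ)
    qed
    ultimately show ?case using v by (intro bexI[of _ g]) (auto simp: mult.assoc)
  qed
  then show ?thesis using C r by (intro exI[of _ "2 * C"] exI[of _ r]) auto
qed


section \<open>Windows of the innovation array on the original space\<close>

context prob_space
begin

context
  fixes \<epsilon> :: "int \<Rightarrow> int \<Rightarrow> 'a \<Rightarrow> real" and G :: "(int \<Rightarrow> real) \<Rightarrow> real"
  assumes iid: "iid_array M \<epsilon>"
    and G[measurable]: "G \<in> borel_measurable (\<Pi>\<^sub>M k\<in>(UNIV :: int set). borel)"
begin

lemma indep_innovations: "indep_vars (\<lambda>_. borel) (\<lambda>(i, j). \<epsilon> i j) UNIV"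
  using iid by (simp add: iid_array_def)

lemma innovation_measurable [measurable]: "random_variable borel (\<epsilon> i j)"
  using indep_innovations by (force simp: indep_vars_def)

lemma window_measurable [measurable]:
  "(\<lambda>\<omega>. \<lambda>l\<in>K. \<epsilon> i (j + l) \<omega>) \<in> measurable M (\<Pi>\<^sub>M l\<in>K. borel)"
  by (rule measurable_restrict) measurable

lemma err_measurable [measurable]: "random_variable borel (err G \<epsilon> i j)"
  using measurable_compose[OF window_measurable[where K = UNIV and i = i and j = j] G] by (simp add: err_def[abs_def] restrict_UNIV)

text \<open>Cutting the array into singleton blocks carries independence over to the row read from
  position \<open>j\<close>. The law obtained does not depend on \<open>i\<close> and
  \<open>j\<close>: this is the stationarity of the errors, and it links condition (D), stated on
  the canonical space, with \<open>M\<close>.\<close>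

lemma distr_window:
  "distr M (\<Pi>\<^sub>M k\<in>UNIV. borel) (\<lambda>\<omega> k. \<epsilon> i (j + k) \<omega>) = (\<Pi>\<^sub>M k\<in>UNIV. distr M borel (\<epsilon> 0 0))"
proof -
  have "indep_vars (\<lambda>k. \<Pi>\<^sub>M p\<in>{(i, j + k)}. borel) (\<lambda>k \<omega>. restrict (\<lambda>p. (\<lambda>(i, j). \<epsilon> i j) p \<omega>) {(i, j + k)}) UNIV"
    by (rule indep_vars_restrict[OF indep_innovations]) (auto simp: disjoint_family_on_def)
  then have "indep_vars (\<lambda>_. borel) (\<lambda>k \<omega>. (\<lambda>f. f (i, j + k)) (restrict (\<lambda>p. (\<lambda>(i, j). \<epsilon> i j) p \<omega>) {(i, j + k)})) UNIV"
    by (rule indep_vars_compose2) (auto intro: measurable_component_singleton)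
  then have "indep_vars (\<lambda>_. borel) (\<lambda>k. \<epsilon> i (j + k)) UNIV" by simp
  then have "distr M (\<Pi>\<^sub>M k\<in>UNIV. borel) (\<lambda>\<omega>. \<lambda>k\<in>UNIV. \<epsilon> i (j + k) \<omega>) = (\<Pi>\<^sub>M k\<in>UNIV. distr M borel (\<epsilon> i (j + k)))"
    by (subst (asm) indep_vars_iff_distr_eq_PiM) auto
  moreover have "distr M borel (\<epsilon> i (j + k)) = distr M borel (\<epsilon> 0 0)" for k
    using iid by (simp add: iid_array_def)
  ultimately show ?thesis by (simp add: restrict_UNIV)
qed

lemma prob_window:
  assumes "A \<in> sets (\<Pi>\<^sub>M k\<in>(UNIV :: int set). borel)"
  shows "prob {\<omega> \<in> space M. (\<lambda>k. \<epsilon> i (j + k) \<omega>) \<in> A} = measure (\<Pi>\<^sub>M k\<in>UNIV. distr M borel (\<epsilon> 0 0)) A"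
proof -
  have "(\<lambda>\<omega> k. \<epsilon> i (j + k) \<omega>) \<in> measurable M (\<Pi>\<^sub>M k\<in>(UNIV :: int set). borel)"
    using window_measurable[where K = UNIV and i = i and j = j] by (simp add: restrict_UNIV)
  then show ?thesis
    unfolding distr_window[of i j, symmetric] using assms
    by (subst measure_distr) (auto intro!: arg_cong[of _ _ prob])
qed

text \<open>The density is given for the error at (0, 0) only; stationarity transfers the bound to
  every position.\<close>

lemma err_prob_interval:
  assumes "has_bounded_density M (err G \<epsilon> 0 0)"
  shows "\<exists>B\<ge>0. \<forall>i j s s'. s \<le> s' \<longrightarrow> prob {\<omega> \<in> space M. err G \<epsilon> i j \<omega> \<in> {s..s'}} \<le> B * (s' - s)"
proof -
  obtain f B where f: "distributed M lborel (err G \<epsilon> 0 0) (\<lambda>u. ennreal (f u))" and fB: "\<And>u. 0 \<le> f u \<and> f u \<le> B"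
    using assms by (auto simp: has_bounded_density_def)
  have B: "0 \<le> B" using fB[of 0] by linarith
  have "prob {\<omega> \<in> space M. err G \<epsilon> i j \<omega> \<in> {s..s'}} \<le> B * (s' - s)" if "s \<le> s'" for i j s s'
  proof -
    have GA: "G -` {s..s'} \<in> sets (\<Pi>\<^sub>M k\<in>(UNIV :: int set). borel)"
      using measurable_sets[OF G, of "{s..s'}"] by (simp add: space_PiM)
    have "prob {\<omega> \<in> space M. err G \<epsilon> i j \<omega> \<in> {s..s'}} = prob {\<omega> \<in> space M. err G \<epsilon> 0 0 \<omega> \<in> {s..s'}}"
      using prob_window[OF GA, of i j] prob_window[OF GA, of 0 0] by (simp add: err_def)
    also have "ennreal \<dots> = emeasure M (err G \<epsilon> 0 0 -` {s..s'} \<inter> space M)"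
      by (auto simp: emeasure_eq_measure intro!: arg_cong[of _ _ prob])
    also have "\<dots> = (\<integral>\<^sup>+u. ennreal (f u) * indicator {s..s'} u \<partial>lborel)"
      by (rule distributed_emeasure[OF f]) simp
    also have "\<dots> \<le> (\<integral>\<^sup>+u. ennreal B * indicator {s..s'} u \<partial>lborel)"
      using fB by (intro nn_integral_mono mult_right_mono ennreal_leI) auto
    also have "\<dots> = ennreal (B * (s' - s))"
      using that B by (simp add: nn_integral_cmult ennreal_mult)
    finally show ?thesis using B that by simp
  qed
  then show ?thesis using B by blast
qed

text \<open>The comparisons of the error and of \<open>g\<close> with \<open>s\<close> can differ
  only if the two are more than \<open>r ^ k\<close> apart or the error lies within
  \<open>r ^ k\<close> of \<open>s\<close>. Both probabilities are bounded uniformly in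
  \<open>i\<close>, \<open>j\<close> and \<open>s\<close>, so one \<open>g\<close> serves all
  observations and thresholds.\<close>

lemma err_threshold_approx:
  assumes D: "condition_D (distr M borel (\<epsilon> 0 0)) G" and dens: "has_bounded_density M (err G \<epsilon> 0 0)"
  shows "\<exists>C r. 0 < C \<and> 0 < r \<and> r < 1 \<and>
    (\<forall>\<^sub>F k in sequentially. \<exists>g\<in>borel_measurable (\<Pi>\<^sub>M l\<in>{- int k..int k}. borel). \<forall>i j s.
       prob {\<omega> \<in> space M. (err G \<epsilon> i j \<omega> \<le> s) \<noteq> (g (\<lambda>l\<in>{- int k..int k}. \<epsilon> i (j + l) \<omega>) \<le> s)} \<le> C * r ^ k)"
proof -
  let ?P = "distr M borel (\<epsilon> 0 0)"
  obtain B where B: "B \<ge> 0"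
    and Bb: "\<And>i j s s'. s \<le> s' \<Longrightarrow> prob {\<omega> \<in> space M. err G \<epsilon> i j \<omega> \<in> {s..s'}} \<le> B * (s' - s)"
    using err_prob_interval[OF dens] by blast
  obtain C r where C: "0 < C" and r: "0 < r" "r < 1" and ev:
    "\<forall>\<^sub>F k in sequentially. \<exists>g\<in>borel_measurable (\<Pi>\<^sub>M l\<in>{- int k..int k}. borel).
       measure (\<Pi>\<^sub>M j\<in>UNIV. ?P) {u. \<bar>G u - g (restrict u {- int k..int k})\<bar> > r ^ k} \<le> C * r ^ k"
    using finite_range_approx[OF D _ _ G] prob_space_distr[of "\<epsilon> 0 0" borel] by auto
  have "\<forall>\<^sub>F k in sequentially. \<exists>g\<in>borel_measurable (\<Pi>\<^sub>M l\<in>{- int k..int k}. borel). \<forall>i j s.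
       prob {\<omega> \<in> space M. (err G \<epsilon> i j \<omega> \<le> s) \<noteq> (g (\<lambda>l\<in>{- int k..int k}. \<epsilon> i (j + l) \<omega>) \<le> s)} \<le> (C + 2 * B) * r ^ k"
    using ev
  proof eventually_elim
    case (elim k)
    let ?K = "{- int k..int k}"
    obtain g where g[measurable]: "g \<in> borel_measurable (\<Pi>\<^sub>M l\<in>?K. borel)"
      and gb: "measure (\<Pi>\<^sub>M j\<in>UNIV. ?P) {u. \<bar>G u - g (restrict u ?K)\<bar> > r ^ k} \<le> C * r ^ k"
      using elim by blast
    have "prob {\<omega> \<in> space M. (err G \<epsilon> i j \<omega> \<le> s) \<noteq> (g (\<lambda>l\<in>?K. \<epsilon> i (j + l) \<omega>) \<le> s)} \<le> (C + 2 * B) * r ^ k" for i j s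
    proof -
      have rs[measurable]: "(\<lambda>u. restrict u ?K) \<in> measurable (\<Pi>\<^sub>M k\<in>(UNIV :: int set). borel) (\<Pi>\<^sub>M l\<in>?K. borel)"
        by (rule measurable_restrict_subset) auto
      have A: "{u. \<bar>G u - g (restrict u ?K)\<bar> > r ^ k} \<in> sets (\<Pi>\<^sub>M k\<in>(UNIV :: int set). borel)"
      proof -
        have "{u \<in> space (\<Pi>\<^sub>M k\<in>(UNIV :: int set). borel). \<bar>G u - g (restrict u ?K)\<bar> > r ^ k} \<in> sets (\<Pi>\<^sub>M k\<in>(UNIV :: int set). borel)"
          by measurable
        then show ?thesis by (simp add: space_PiM)
      qed
      have 1: "prob {\<omega> \<in> space M. \<bar>err G \<epsilon> i j \<omega> - g (\<lambda>l\<in>?K. \<epsilon> i (j + l) \<omega>)\<bar> > r ^ k} \<le> C * r ^ k"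
        using prob_window[OF A, of i j] gb by (simp add: err_def restrict_def cong: if_cong)
      have 2: "prob {\<omega> \<in> space M. err G \<epsilon> i j \<omega> \<in> {s - r ^ k..s + r ^ k}} \<le> 2 * B * r ^ k"
        using Bb[of "s - r ^ k" "s + r ^ k" i j] r by (simp add: algebra_simps)
      \<comment> \<open>The event \<open>False\<close> only fills the third slot of the union
        bound.\<close>
      have "prob {\<omega> \<in> space M. (err G \<epsilon> i j \<omega> \<le> s) \<noteq> (g (\<lambda>l\<in>?K. \<epsilon> i (j + l) \<omega>) \<le> s)}
        \<le> prob {\<omega> \<in> space M. \<bar>err G \<epsilon> i j \<omega> - g (\<lambda>l\<in>?K. \<epsilon> i (j + l) \<omega>)\<bar> > r ^ k}
          + prob {\<omega> \<in> space M. err G \<epsilon> i j \<omega> \<in> {s - r ^ k..s + r ^ k}} + prob {\<omega> \<in> space M. False}"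
        by (rule prob_Un3_le) (measurable, auto)
      then show ?thesis using 1 2 by (simp add: algebra_simps)
    qed
    then show ?case using g by blast
  qed
  then show ?thesis using C B r by (intro exI[of _ "C + 2 * B"] exI[of _ r]) auto
qed

text \<open>Two observations of one residue class either belong to different subjects or have
  positions at least 2k+1 apart, so their windows of radius k use disjoint parts of the
  array.\<close>

lemma window_blocks_indep:
  fixes h :: "nat \<times> nat \<Rightarrow> (int \<Rightarrow> real) \<Rightarrow> real"
  assumes h[measurable]: "\<And>p. p \<in> I \<Longrightarrow> h p \<in> borel_measurable (\<Pi>\<^sub>M l\<in>{- int k..int k}. borel)"
  shows "indep_vars (\<lambda>_. borel) (\<lambda>(i, j) \<omega>. h (i, j) (\<lambda>l\<in>{- int k..int k}. \<epsilon> (int i) (int j + l) \<omega>))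
    {p \<in> I. snd p mod (2 * k + 1) = r}"
proof -
  let ?K = "{- int k..int k}"
  let ?L = "{p \<in> I. snd p mod (2 * k + 1) = r}"
  define W where "W = (\<lambda>(i, j). {int i} \<times> {int j - int k..int j + int k})"
  have disj: "disjoint_family_on W ?L"
  proof -
    have "j = j'" if jj: "j mod (2 * k + 1) = j' mod (2 * k + 1)"
      and x: "int j - int k \<le> x" "x \<le> int j + int k" "int j' - int k \<le> x" "x \<le> int j' + int k" for j j' :: nat and x
    proof -
      have "int j mod int (2 * k + 1) = int j' mod int (2 * k + 1)"
        using jj by (simp only: zmod_int[symmetric])
      then have dvd: "int (2 * k + 1) dvd int j - int j'" by (rule mod_eq_dvd_iff[THEN iffD1])
      \<comment> \<open>A common point of both windows puts the centres at most 2k apart, and 0 is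
        the only multiple of 2k+1 in that range.\<close>
      have "\<bar>int j - int j'\<bar> < int (2 * k + 1)" using x by linarith
      then have "int j - int j' = 0" using dvd_imp_le_int[OF _ dvd] by fastforce
      then show ?thesis by simp
    qed
    then show ?thesis by (fastforce simp: disjoint_family_on_def W_def)
  qed
  have "indep_vars (\<lambda>p. \<Pi>\<^sub>M q\<in>W p. borel) (\<lambda>p \<omega>. restrict (\<lambda>q. (\<lambda>(i, j). \<epsilon> i j) q \<omega>) (W p)) ?L"
    by (rule indep_vars_restrict[OF indep_innovations _ disj]) auto
  then have "indep_vars (\<lambda>_. borel) (\<lambda>p \<omega>. (\<lambda>f. h p (\<lambda>l\<in>?K. f (int (fst p), int (snd p) + l)))
      (restrict (\<lambda>q. (\<lambda>(i, j). \<epsilon> i j) q \<omega>) (W p))) ?L"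
  proof (rule indep_vars_compose2)
    fix p assume p: "p \<in> ?L"
    have "(\<lambda>f. \<lambda>l\<in>?K. f (int (fst p), int (snd p) + l)) \<in> measurable (\<Pi>\<^sub>M q\<in>W p. borel) (\<Pi>\<^sub>M l\<in>?K. borel)"
      by (intro measurable_restrict measurable_component_singleton) (auto simp: W_def split: prod.split)
    from measurable_compose[OF this h] p
    show "(\<lambda>f. h p (\<lambda>l\<in>?K. f (int (fst p), int (snd p) + l))) \<in> borel_measurable (\<Pi>\<^sub>M q\<in>W p. borel)"
      by simp
  qed
  moreover have "(\<lambda>f. h p (\<lambda>l\<in>?K. f (int (fst p), int (snd p) + l))) (restrict (\<lambda>q. (\<lambda>(i, j). \<epsilon> i j) q \<omega>) (W p))
    = (\<lambda>(i, j) \<omega>. h (i, j) (\<lambda>l\<in>?K. \<epsilon> (int i) (int j + l) \<omega>)) p \<omega>" for p \<omega>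
    by (cases p) (auto simp: W_def intro!: arg_cong[of _ _ "h _"])
  ultimately show ?thesis by simp
qed

end
end

section \<open>Measurability and discretisation of the supremum\<close>

text \<open>The supremum is uncountable and measurability is part of \<open>bigO_p\<close>.
  Continuity in \<open>t\<close> and right continuity in the threshold reduce it to rational
  points.\<close>

lemma SUP_window_measurable:
  fixes Z :: "real \<Rightarrow> real \<Rightarrow> 'a \<Rightarrow> real"
  assumes \<delta>: "0 < \<delta>" and Zm[measurable]: "\<And>t y. Z t y \<in> borel_measurable M"
    and bdd: "\<And>t y \<omega>. \<bar>Z t y \<omega>\<bar> \<le> K"
    and cont: "\<And>t y \<omega>. ((\<lambda>(t', y'). Z t' y' \<omega>) \<longlongrightarrow> Z t y \<omega>) (nhds t \<times>\<^sub>F at_right y)"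
  shows "(\<lambda>\<omega>. SUP (d, t, y) \<in> {-\<delta>..\<delta>} \<times> UNIV \<times> UNIV. \<bar>Z t (y + d) \<omega> - Z t y \<omega>\<bar>) \<in> borel_measurable M"
proof -
  \<comment> \<open>The third coordinate is the end point \<open>y + d\<close> rather than
    \<open>d\<close>: both end points are approached from the right separately.\<close>
  define Q :: "(real \<times> real \<times> real) set" where "Q = {(t, y, z). t \<in> \<rat> \<and> y \<in> \<rat> \<and> z \<in> \<rat> \<and> \<bar>z - y\<bar> \<le> \<delta>}"
  define f where "f \<omega> = (\<lambda>(t, y, z). \<bar>Z t z \<omega> - Z t y \<omega>\<bar>)" for \<omega>
  define g where "g \<omega> = (\<lambda>(d, t, y). \<bar>Z t (y + d) \<omega> - Z t y \<omega>\<bar>)" for \<omega>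
  define D where "D = {-\<delta>..\<delta>} \<times> (UNIV :: real set) \<times> (UNIV :: real set)"
  have dK: "\<bar>Z t z \<omega> - Z t y \<omega>\<bar> \<le> 2 * K" for t y z \<omega>
    using bdd[of t z \<omega>] bdd[of t y \<omega>] by linarith
  have bddf: "bdd_above (f \<omega> ` S)" for \<omega> S using dK by (intro bdd_aboveI[of _ "2 * K"]) (auto simp: f_def)
  have bddg: "bdd_above (g \<omega> ` S)" for \<omega> S using dK by (intro bdd_aboveI[of _ "2 * K"]) (auto simp: g_def)
  have Q0: "(0, 0, 0) \<in> Q" using \<delta> by (simp add: Q_def)
  have D0: "(0, 0, 0) \<in> D" using \<delta> by (simp add: D_def)
  have "countable Q"
    by (rule countable_subset[of _ "\<rat> \<times> \<rat> \<times> \<rat>"]) (auto simp: Q_def intro!: countable_SIGMA countable_rat)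
  have "(SUP x\<in>D. g \<omega> x) = (SUP x\<in>Q. f \<omega> x)" for \<omega>
  proof (rule antisym)
    show "(SUP x\<in>Q. f \<omega> x) \<le> (SUP x\<in>D. g \<omega> x)"
    proof (rule cSUP_least)
      fix x assume x: "x \<in> Q"
      obtain t y z where [simp]: "x = (t, y, z)" by (cases x)
      have "f \<omega> x = g \<omega> (z - y, t, y)" by (simp add: f_def g_def)
      also have "\<dots> \<le> (SUP x\<in>D. g \<omega> x)"
        using x by (intro cSUP_upper bddg) (auto simp: D_def Q_def)
      finally show "f \<omega> x \<le> (SUP x\<in>D. g \<omega> x)" .
    qed (use Q0 in auto)
    have "g \<omega> x \<le> (SUP x\<in>Q. f \<omega> x)" if x: "x \<in> D" for x
    proof (rule field_le_epsilon)
      fix e :: real assume e: "0 < e"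
      obtain d t y where [simp]: "x = (d, t, y)" by (cases x)
      have d: "- \<delta> \<le> d" "d \<le> \<delta>" using x by (auto simp: D_def)
      have near: "\<exists>h>0. \<forall>t' y'. \<bar>t' - t\<bar> < h \<and> y < y' \<and> y' < y + h \<longrightarrow> \<bar>Z t' y' \<omega> - Z t y \<omega>\<bar> < e / 2" for y
      proof -
        have "\<forall>\<^sub>F (t', y') in nhds t \<times>\<^sub>F at_right y. \<bar>Z t' y' \<omega> - Z t y \<omega>\<bar> < e / 2"
          using tendstoD[OF cont[of \<omega> t y], of "e / 2"] e by (simp add: dist_real_def case_prod_beta')
        then obtain P R where P: "eventually P (nhds t)" and R: "eventually R (at_right y)"
          and PR: "\<And>t' y'. P t' \<Longrightarrow> R y' \<Longrightarrow> \<bar>Z t' y' \<omega> - Z t y \<omega>\<bar> < e / 2"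
          by (auto simp: eventually_prod_filter)
        obtain h1 where h1: "h1 > 0" "\<And>t'. dist t' t < h1 \<Longrightarrow> P t'"
          using P by (auto simp: eventually_nhds_metric)
        obtain b where b: "b > y" "\<And>y'. y < y' \<Longrightarrow> y' < b \<Longrightarrow> R y'"
          using R eventually_at_right_field by blast
        show ?thesis
        proof (intro exI[of _ "min h1 (b - y)"] conjI allI impI)
          show "0 < min h1 (b - y)" using h1(1) b(1) by simp
          fix t' y' assume *: "\<bar>t' - t\<bar> < min h1 (b - y) \<and> y < y' \<and> y' < y + min h1 (b - y)"
          have "P t'" using * by (intro h1(2)) (simp add: dist_real_def)
          moreover have "R y'" using * by (intro b(2)) auto
          ultimately show "\<bar>Z t' y' \<omega> - Z t y \<omega>\<bar> < e / 2" by (rule PR)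
        qed
      qed
      obtain h1 where h1: "h1 > 0" "\<forall>t' y'. \<bar>t' - t\<bar> < h1 \<and> y < y' \<and> y' < y + h1 \<longrightarrow> \<bar>Z t' y' \<omega> - Z t y \<omega>\<bar> < e / 2"
        using near[of y] by (elim exE conjE)
      obtain h2 where h2: "h2 > 0" "\<forall>t' z'. \<bar>t' - t\<bar> < h2 \<and> y + d < z' \<and> z' < y + d + h2 \<longrightarrow> \<bar>Z t' z' \<omega> - Z t (y + d) \<omega>\<bar> < e / 2"
        using near[of "y + d"] by (elim exE conjE)
      define h where "h = min \<delta> (min h1 h2)"
      have h: "h > 0" "h \<le> \<delta>" "h \<le> h1" "h \<le> h2" using h1(1) h2(1) \<delta> by (auto simp: h_def)
      obtain t' where t': "t' \<in> \<rat>" "t < t'" "t' < t + h" using Rats_dense_in_real[of t "t + h"] h by auto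
      \<comment> \<open>Moving both end points to the right must not push their distance beyond
        \<delta>, even if |d| = \<delta>. For d \<ge> 0 the lower end \<open>y\<close> is moved
        further than \<open>y + d\<close>, for d < 0 the other way round; the window then shrinks in
        absolute value or changes sign, and h \<le> \<delta> covers the change of sign.\<close>
      have "\<exists>y' z'. y' \<in> \<rat> \<and> z' \<in> \<rat> \<and> y < y' \<and> y' < y + h \<and> y + d < z' \<and> z' < y + d + h \<and> \<bar>z' - y'\<bar> \<le> \<delta>"
      proof (cases "0 \<le> d")
        case True
        obtain y' where y': "y' \<in> \<rat>" "y + h / 2 < y'" "y' < y + h" using Rats_dense_in_real[of "y + h / 2" "y + h"] h by auto
        obtain z' where z': "z' \<in> \<rat>" "y + d < z'" "z' < y + d + h / 2" using Rats_dense_in_real[of "y + d" "y + d + h / 2"] h by auto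
        have "\<bar>z' - y'\<bar> \<le> \<delta>" using y'(2,3) z'(2,3) h(1,2) d True by (simp only: abs_le_iff) linarith
        moreover have "y < y'" "y' < y + h" "y + d < z'" "z' < y + d + h" using y'(2,3) z'(2,3) h(1) by linarith+
        ultimately show ?thesis using y'(1) z'(1) by blast
      next
        case False
        obtain y' where y': "y' \<in> \<rat>" "y < y'" "y' < y + h / 2" using Rats_dense_in_real[of y "y + h / 2"] h by auto
        obtain z' where z': "z' \<in> \<rat>" "y + d + h / 2 < z'" "z' < y + d + h" using Rats_dense_in_real[of "y + d + h / 2" "y + d + h"] h by auto
        have "\<bar>z' - y'\<bar> \<le> \<delta>" using y'(2,3) z'(2,3) h(1,2) d False by (simp only: abs_le_iff) linarith
        moreover have "y < y'" "y' < y + h" "y + d < z'" "z' < y + d + h" using y'(2,3) z'(2,3) h(1) by linarith+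
        ultimately show ?thesis using y'(1) z'(1) by blast
      qed
      then obtain y' z' where yz: "y' \<in> \<rat>" "z' \<in> \<rat>" "y < y'" "y' < y + h" "y + d < z'" "z' < y + d + h" "\<bar>z' - y'\<bar> \<le> \<delta>"
        by blast
      have "\<bar>Z t' y' \<omega> - Z t y \<omega>\<bar> < e / 2" using yz t' h by (intro h1(2)[rule_format]) (auto simp del: abs_le_iff)
      moreover have "\<bar>Z t' z' \<omega> - Z t (y + d) \<omega>\<bar> < e / 2" using yz t' h by (intro h2(2)[rule_format]) auto
      ultimately have "\<bar>Z t (y + d) \<omega> - Z t y \<omega>\<bar> \<le> \<bar>Z t' z' \<omega> - Z t' y' \<omega>\<bar> + e" by linarith
      then have "g \<omega> x \<le> f \<omega> (t', y', z') + e" by (simp add: f_def g_def)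
      also have "f \<omega> (t', y', z') \<le> (SUP x\<in>Q. f \<omega> x)"
        using yz t' by (intro cSUP_upper bddf) (auto simp: Q_def)
      finally show "g \<omega> x \<le> (SUP x\<in>Q. f \<omega> x) + e" by simp
    qed
    then show "(SUP x\<in>D. g \<omega> x) \<le> (SUP x\<in>Q. f \<omega> x)"
      using D0 by (intro cSUP_least) auto
  qed
  moreover have "(\<lambda>\<omega>. SUP x\<in>Q. f \<omega> x) \<in> borel_measurable M"
    using \<open>countable Q\<close> bddf by (intro borel_measurable_cSUP) (auto simp: f_def)
  ultimately show ?thesis unfolding D_def g_def by simp
qed

section \<open>Continuity, Lipschitz dependence and monotone comparison for the centred
  process\<close>

context prob_space
begin

lemma cemp_measurable:
  assumes "\<And>i. i \<in> I \<Longrightarrow> random_variable borel (X i)" "A \<in> sets borel"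
  shows "cemp M I X v A \<in> borel_measurable M"
  unfolding cemp_def using assms
  by (intro borel_measurable_sum borel_measurable_times borel_measurable_diff borel_measurable_const
      measurable_compose[OF _ borel_measurable_indicator]) auto

lemma abs_indicator_minus_prob_le: "\<bar>indicat_real A x - prob B\<bar> \<le> 1"
  by (auto simp: indicator_def)

lemma cemp_lipschitz:
  assumes "\<And>i. i \<in> I \<Longrightarrow> \<bar>v i - v' i\<bar> \<le> e"
  shows "\<bar>cemp M I X v A \<omega> - cemp M I X v' A \<omega>\<bar> \<le> real (card I) * e"
proof -
  have "\<bar>cemp M I X v A \<omega> - cemp M I X v' A \<omega>\<bar> =
      \<bar>\<Sum>i\<in>I. (v i - v' i) * (indicat_real A (X i \<omega>) - prob {\<omega>' \<in> space M. X i \<omega>' \<in> A})\<bar>"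
    by (simp add: cemp_def sum_subtractf left_diff_distrib)
  also have "\<dots> \<le> (\<Sum>i\<in>I. e * 1)"
  proof (intro order_trans[OF sum_abs] sum_mono)
    fix i assume "i \<in> I"
    then show "\<bar>(v i - v' i) * (indicat_real A (X i \<omega>) - prob {\<omega>' \<in> space M. X i \<omega>' \<in> A})\<bar> \<le> e * 1"
      unfolding abs_mult using assms abs_indicator_minus_prob_le
      by (intro mult_mono) (auto intro: order_trans[OF abs_ge_zero])
  qed
  finally show ?thesis by simp
qed

lemma cemp_abs_le:
  assumes "\<And>i. i \<in> I \<Longrightarrow> 0 \<le> v i \<and> v i \<le> c"
  shows "\<bar>cemp M I X v A \<omega>\<bar> \<le> real (card I) * c"
  using cemp_lipschitz[of I v "\<lambda>_. 0" c X A \<omega>] assms by (simp add: cemp_def)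

text \<open>The limit is joint because the rational points approach \<open>t\<close> and
  \<open>y\<close> simultaneously. Indicators of half-lines and distribution functions are in
  general continuous only from the right, hence \<open>at_right\<close>.\<close>

lemma cemp_right_cont:
  assumes X: "\<And>i. i \<in> I \<Longrightarrow> random_variable borel (X i)"
    and v: "\<And>i. i \<in> I \<Longrightarrow> isCont (\<lambda>t. v t i) t"
  shows "((\<lambda>(t', y'). cemp M I X (v t') {..y'} \<omega>) \<longlongrightarrow> cemp M I X (v t) {..y} \<omega>) (nhds t \<times>\<^sub>F at_right y)"
  unfolding cemp_def case_prod_beta
proof (intro tendsto_sum tendsto_mult tendsto_diff)
  fix i assume i: "i \<in> I"
  have "((\<lambda>t'. v t' i) \<longlongrightarrow> v t i) (nhds t)" using v[OF i] by (simp add: isCont_def tendsto_at_iff_tendsto_nhds[of "\<lambda>t. v t i"])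
  then show "((\<lambda>x. v (fst x) i) \<longlongrightarrow> v t i) (nhds t \<times>\<^sub>F at_right y)"
    by (rule filterlim_compose[OF _ filterlim_fst])
  have "((\<lambda>y'. indicat_real {..y'} (X i \<omega>)) \<longlongrightarrow> indicat_real {..y} (X i \<omega>)) (at_right y)"
  proof (cases "X i \<omega> \<le> y")
    case True
    then have "\<forall>\<^sub>F y' in at_right y. indicat_real {..y'} (X i \<omega>) = indicat_real {..y} (X i \<omega>)"
      by (auto simp: eventually_at_filter indicator_def intro!: always_eventually)
    then show ?thesis by (rule tendsto_eventually)
  next
    case False
    then have "\<forall>\<^sub>F y' in at_right y. indicat_real {..y'} (X i \<omega>) = indicat_real {..y} (X i \<omega>)"
      by (auto simp: eventually_at_right_field indicator_def intro!: exI[of _ "X i \<omega>"])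
    then show ?thesis by (rule tendsto_eventually)
  qed
  then show "((\<lambda>x. indicat_real {..snd x} (X i \<omega>)) \<longlongrightarrow> indicat_real {..y} (X i \<omega>)) (nhds t \<times>\<^sub>F at_right y)"
    by (rule filterlim_compose[OF _ filterlim_snd])
  interpret R: real_distribution "distr M borel (X i)" using X[OF i] by (rule real_distribution_distr)
  have eq: "cdf (distr M borel (X i)) y = prob {\<omega>' \<in> space M. X i \<omega>' \<in> {..y}}" for y
    using X[OF i] by (simp add: cdf_def measure_distr vimage_def Int_def conj_commute)
  have "((\<lambda>y'. prob {\<omega>' \<in> space M. X i \<omega>' \<in> {..y'}}) \<longlongrightarrow> prob {\<omega>' \<in> space M. X i \<omega>' \<in> {..y}}) (at_right y)"
    using R.cdf_is_right_cont[of y] unfolding eq[symmetric] by (simp add: continuous_within)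
  then show "((\<lambda>x. prob {\<omega>' \<in> space M. X i \<omega>' \<in> {..snd x}}) \<longlongrightarrow> prob {\<omega>' \<in> space M. X i \<omega>' \<in> {..y}})
      (nhds t \<times>\<^sub>F at_right y)"
    by (rule filterlim_compose[OF _ filterlim_snd])
qed

text \<open>With nonnegative weights the indicator parts are ordered by inclusion; only the centring
  works against the order, by at most the mass \<gamma> of the cell per observation.\<close>

lemma cemp_sandwich:
  assumes X[measurable]: "\<And>i. i \<in> I \<Longrightarrow> random_variable borel (X i)"
    and [measurable]: "A \<in> sets borel" "S \<in> sets borel" "A' \<in> sets borel" and sub: "A \<subseteq> S" "S \<subseteq> A'"
    and v: "\<And>i. i \<in> I \<Longrightarrow> 0 \<le> v i \<and> v i \<le> c"
    and \<gamma>: "\<And>i. i \<in> I \<Longrightarrow> prob {\<omega> \<in> space M. X i \<omega> \<in> A'} - prob {\<omega> \<in> space M. X i \<omega> \<in> A} \<le> \<gamma>"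
  shows "cemp M I X v S \<omega> \<le> cemp M I X v A' \<omega> + c * real (card I) * \<gamma>"
    and "cemp M I X v A \<omega> \<le> cemp M I X v S \<omega> + c * real (card I) * \<gamma>"
proof -
  have p: "prob {\<omega> \<in> space M. X i \<omega> \<in> A} \<le> prob {\<omega> \<in> space M. X i \<omega> \<in> S}"
    "prob {\<omega> \<in> space M. X i \<omega> \<in> S} \<le> prob {\<omega> \<in> space M. X i \<omega> \<in> A'}" if [measurable]: "i \<in> I" for i
    using sub by (auto intro!: finite_measure_mono)
  have ind: "indicat_real A x \<le> indicat_real S x" "indicat_real S x \<le> indicat_real A' x" for x
    using sub by (auto simp: indicator_def)
  have step: "v i * (a - b) \<le> v i * (a' - b') + c * \<gamma>"
    if i: "i \<in> I" and "a \<le> a'" "b' - b \<le> \<gamma>" "0 \<le> \<gamma>" for i a a' b b'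
  proof -
    have "v i * (a - b) \<le> v i * (a' - b' + \<gamma>)" using that v[OF i] by (intro mult_left_mono) auto
    also have "\<dots> = v i * (a' - b') + v i * \<gamma>" by (simp add: distrib_left)
    also have "v i * \<gamma> \<le> c * \<gamma>" using that v[OF i] by (intro mult_right_mono) auto
    finally show ?thesis by simp
  qed
  have \<gamma>0: "0 \<le> \<gamma>" if "i \<in> I" for i using \<gamma>[OF that] p[OF that] by linarith
  have \<gamma>': "prob {\<omega> \<in> space M. X i \<omega> \<in> A'} - prob {\<omega> \<in> space M. X i \<omega> \<in> S} \<le> \<gamma>"
    "prob {\<omega> \<in> space M. X i \<omega> \<in> S} - prob {\<omega> \<in> space M. X i \<omega> \<in> A} \<le> \<gamma>" if "i \<in> I" for i
    using p[OF that] \<gamma>[OF that] by linarith+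
  have sum_eq: "(\<Sum>i\<in>I. f i + c * \<gamma>) = (\<Sum>i\<in>I. f i) + c * real (card I) * \<gamma>" for f
    by (simp add: sum.distrib)
  show "cemp M I X v S \<omega> \<le> cemp M I X v A' \<omega> + c * real (card I) * \<gamma>"
    unfolding cemp_def sum_eq[symmetric] 
    by (rule sum_mono, rule step) (use ind \<gamma>' \<gamma>0 in blast)+
  show "cemp M I X v A \<omega> \<le> cemp M I X v S \<omega> + c * real (card I) * \<gamma>"
    unfolding cemp_def sum_eq[symmetric] 
    by (rule sum_mono, rule step) (use ind \<gamma>' \<gamma>0 in blast)+
qed

lemma prob_nested_diff:
  assumes [measurable]: "X \<in> borel_measurable M" "A \<in> sets borel" "B \<in> sets borel" and "A \<subseteq> B"
  shows "prob {\<omega> \<in> space M. (X \<omega> \<in> A) \<noteq> (X \<omega> \<in> B)} = prob {\<omega> \<in> space M. X \<omega> \<in> B} - prob {\<omega> \<in> space M. X \<omega> \<in> A}"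
proof -
  have "prob ({\<omega> \<in> space M. X \<omega> \<in> B} - {\<omega> \<in> space M. X \<omega> \<in> A}) = prob {\<omega> \<in> space M. X \<omega> \<in> B} - prob {\<omega> \<in> space M. X \<omega> \<in> A}"
    using assms(4) by (intro finite_measure_Diff) auto
  moreover have "{\<omega> \<in> space M. X \<omega> \<in> B} - {\<omega> \<in> space M. X \<omega> \<in> A} = {\<omega> \<in> space M. (X \<omega> \<in> A) \<noteq> (X \<omega> \<in> B)}"
    using assms(4) by auto
  ultimately show ?thesis by simp
qed

end

text \<open>The two extreme sets play the roles of the thresholds at minus and plus infinity and
  close the grid at its ends. Truncating an error cannot change membership in them, so the
  approximation bound extends to them.\<close>

definition half_line :: "real set \<Rightarrow> bool" where
  "half_line A \<longleftrightarrow> A = {} \<or> A = UNIV \<or> (\<exists>s. A = {..s})"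

lemma half_line_borel: "half_line A \<Longrightarrow> A \<in> sets borel"
  by (auto simp: half_line_def)

lemma half_line_chain: "half_line A \<Longrightarrow> A \<subseteq> {..y} \<or> {..y} \<subseteq> A"
  by (auto simp: half_line_def)

text \<open>
  The grid consists of quantiles of the averaged law, because the tails of the observations are
  not controlled.
\<close>

lemma (in prob_space) half_line_grid:
  fixes X :: "'i \<Rightarrow> 'a \<Rightarrow> real"
  assumes fin: "finite I" "I \<noteq> {}" and X: "\<And>i. i \<in> I \<Longrightarrow> random_variable borel (X i)"
    and atomless: "\<And>i s. i \<in> I \<Longrightarrow> prob {\<omega> \<in> space M. X i \<omega> = s} = 0" and L: "0 < L"
  shows "\<exists>A :: nat \<Rightarrow> real set. (\<forall>l. half_line (A l)) \<and> (\<forall>y. \<exists>l<L. A l \<subseteq> {..y} \<and> {..y} \<subseteq> A (Suc l)) \<and>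
    (\<forall>l<L. \<forall>i\<in>I. prob {\<omega> \<in> space M. X i \<omega> \<in> A (Suc l)} - prob {\<omega> \<in> space M. X i \<omega> \<in> A l} \<le> real (card I) / real L)"
proof -
  define N where "N = real (card I)"
  have N: "N > 0" using fin by (simp add: N_def card_gt_0_iff)
  define p where "p i B = prob {\<omega> \<in> space M. X i \<omega> \<in> B}" for i and B :: "real set"
  \<comment> \<open>The sum of all distribution functions is continuous, as there are no atoms, and
    runs from 0 to the number of observations.\<close>
  define H where "H s = (\<Sum>i\<in>I. p i {..s})" for s
  have cdf: "cdf (distr M borel (X i)) s = p i {..s}" if "i \<in> I" for i s
    using X[OF that] by (simp add: p_def cdf_def measure_distr vimage_def Int_def conj_commute)
  have lim: "((\<lambda>s. p i {..s}) \<longlongrightarrow> 1) at_top" "((\<lambda>s. p i {..s}) \<longlongrightarrow> 0) at_bot" "isCont (\<lambda>s. p i {..s}) s"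
    if "i \<in> I" for i s
  proof -
    interpret R: real_distribution "distr M borel (X i)" using X[OF that] by (rule real_distribution_distr)
    show "((\<lambda>s. p i {..s}) \<longlongrightarrow> 1) at_top" "((\<lambda>s. p i {..s}) \<longlongrightarrow> 0) at_bot"
      unfolding cdf[OF that, symmetric] by (rule R.cdf_lim_at_top_prob R.cdf_lim_at_bot)+
    have "measure (distr M borel (X i)) {s} = 0"
      using X[OF that] atomless[OF that, of s] by (simp add: measure_distr vimage_def Int_def conj_commute)
    then show "isCont (\<lambda>s. p i {..s}) s"
      unfolding cdf[OF that, symmetric] by (simp add: R.isCont_cdf)
  qed
  have "(H \<longlongrightarrow> (\<Sum>i\<in>I. 1)) at_top" "(H \<longlongrightarrow> (\<Sum>i\<in>I. 0)) at_bot"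
    unfolding H_def using lim by (intro tendsto_sum; blast)+
  then have Htop: "(H \<longlongrightarrow> N) at_top" and Hbot: "(H \<longlongrightarrow> 0) at_bot" by (simp_all add: N_def)
  have Hcont: "isCont H s" for s unfolding H_def using lim by (auto intro!: continuous_sum)
  have Hmono: "H s \<le> H s'" if "s \<le> s'" for s s'
    unfolding H_def p_def using that X by (intro sum_mono finite_measure_mono) auto
  have "\<exists>s. H s = real l * N / real L" if l: "0 < l" "l < L" for l
  proof -
    have "0 < real l * N / real L" "real l * N / real L < N" using l N by (auto simp: field_simps)
    then have "\<forall>\<^sub>F s in at_bot. H s < real l * N / real L" "\<forall>\<^sub>F s in at_top. real l * N / real L < H s"
      using order_tendstoD(2)[OF Hbot] order_tendstoD(1)[OF Htop] by auto
    then obtain a b where ab: "H a < real l * N / real L" "real l * N / real L < H b"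
      by (auto simp: eventually_at_bot_linorder eventually_at_top_linorder)
    then have "a \<le> b" using Hmono[of b a] by linarith
    then show ?thesis using ab Hcont IVT[of H a "real l * N / real L" b] by auto
  qed
  then obtain s where s: "\<And>l. 0 < l \<Longrightarrow> l < L \<Longrightarrow> H (s l) = real l * N / real L" by metis
  \<comment> \<open>\<open>L\<close> cells need the \<open>L + 1\<close> sets \<open>A 0\<close> to
    \<open>A L\<close>; the interior ones are the levels of \<open>H\<close>, obtained from the
    intermediate value theorem.\<close>
  define A where "A l = (if l = 0 then {} else if l < L then {..s l} else UNIV)" for l
  have half: "half_line (A l)" for l by (auto simp: A_def half_line_def)
  have mass: "(\<Sum>i\<in>I. p i (A l)) = real l * N / real L" if lL: "l \<le> L" for l
  proof -
    consider "l = 0" | "0 < l" "l < L" | "l = L" using lL by (metis le_neq_implies_less neq0_conv)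
    then show ?thesis
    proof cases
      case 1 then show ?thesis by (simp add: A_def p_def)
    next
      case 2 then show ?thesis using s by (simp add: A_def H_def)
    next
      case 3 then show ?thesis using L by (simp add: A_def p_def prob_space N_def)
    qed
  qed
  have mono: "A l \<subseteq> A (Suc l)" if l: "l < L" for l
  proof -
    have "s l \<le> s (Suc l)" if "0 < l" "Suc l < L"
    proof (rule ccontr)
      assume "\<not> ?thesis"
      then have "H (s (Suc l)) \<le> H (s l)" by (intro Hmono) auto
      then show False using s[of l] s[of "Suc l"] that N L by (simp add: field_simps mult_le_0_iff)
    qed
    then show ?thesis using l by (auto simp: A_def)
  qed
  have "p i (A (Suc l)) - p i (A l) \<le> N / real L" if l: "l < L" and i: "i \<in> I" for l i
  proof -
    \<comment> \<open>All increments are nonnegative, so each single law gives a cell at most the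
      summed mass of the cell. This makes one grid fine for all laws at once.\<close>
    have "p i (A (Suc l)) - p i (A l) \<le> (\<Sum>i\<in>I. p i (A (Suc l)) - p i (A l))"
      using fin mono[OF l] X half_line_borel[OF half]
      by (intro member_le_sum[OF i]) (auto simp: p_def intro!: finite_measure_mono)
    also have "\<dots> = N / real L" using mass[of l] mass[of "Suc l"] l L
      by (simp add: sum_subtractf diff_divide_distrib[symmetric] algebra_simps)
    finally show ?thesis .
  qed
  moreover have "\<exists>l<L. A l \<subseteq> {..y} \<and> {..y} \<subseteq> A (Suc l)" for y
  proof -
    \<comment> \<open>The last grid set inside \<open>{..y}\<close>: its successor is not inside,
      and half-lines form a chain, so the successor contains \<open>{..y}\<close>.\<close>
    define l where "l = Max {l. l \<le> L \<and> A l \<subseteq> {..y}}"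
    have ne: "0 \<in> {l. l \<le> L \<and> A l \<subseteq> {..y}}" and fs: "finite {l. l \<le> L \<and> A l \<subseteq> {..y}}" by (auto simp: A_def)
    have l: "l \<le> L" "A l \<subseteq> {..y}" using Max_in[OF fs] ne unfolding l_def by blast+
    moreover have "l \<noteq> L"
    proof
      assume "l = L"
      then have "y + 1 \<in> {..y}" using l L by (auto simp: A_def)
      then show False by simp
    qed
    ultimately have lL: "l < L" by simp
    have "\<not> A (Suc l) \<subseteq> {..y}"
    proof
      assume "A (Suc l) \<subseteq> {..y}"
      then have "Suc l \<le> l" unfolding l_def using lL by (intro Max_ge[OF fs]) (auto simp: l_def)
      then show False by simp
    qed
    then have "{..y} \<subseteq> A (Suc l)" using half_line_chain[OF half, of "Suc l" y] by blast
    then show ?thesis using lL l by blast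
  qed
  ultimately show ?thesis using half unfolding p_def N_def by blast
qed

section \<open>From arbitrary pairs of thresholds to pairs of grid sets\<close>

context prob_space
begin

text \<open>The bound \<open>K\<close> is available only for grid pairs that are close in every law.
  Replacing \<open>y\<close> and \<open>z\<close> by grid neighbours moves each of them by mass at
  most \<gamma>; the margin \<open>2 * \<gamma>\<close> in \<open>yz\<close> keeps the resulting
  pairs admissible.\<close>

lemma cemp_discretise:
  fixes X :: "'i \<Rightarrow> 'a \<Rightarrow> real"
  assumes X[measurable]: "\<And>i. i \<in> I \<Longrightarrow> random_variable borel (X i)"
    and half: "\<And>l. half_line (A l)"
    and grid: "\<And>y. \<exists>l<L. A l \<subseteq> {..y} \<and> {..y} \<subseteq> A (Suc l)"
    and \<gamma>: "\<And>l i. l < L \<Longrightarrow> i \<in> I \<Longrightarrow>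
      prob {\<omega> \<in> space M. X i \<omega> \<in> A (Suc l)} - prob {\<omega> \<in> space M. X i \<omega> \<in> A l} \<le> \<gamma>"
    and v: "\<And>i. i \<in> I \<Longrightarrow> 0 \<le> v i \<and> v i \<le> c"
    and yz: "\<And>i. i \<in> I \<Longrightarrow> prob {\<omega> \<in> space M. (X i \<omega> \<in> {..y}) \<noteq> (X i \<omega> \<in> {..z})} + 2 * \<gamma> \<le> \<beta>"
    and K: "\<And>k l. k \<le> L \<Longrightarrow> l \<le> L \<Longrightarrow>
      (\<And>i. i \<in> I \<Longrightarrow> prob {\<omega> \<in> space M. (X i \<omega> \<in> A k) \<noteq> (X i \<omega> \<in> A l)} \<le> \<beta>) \<Longrightarrow>
      \<bar>cemp M I X v (A k) \<omega> - cemp M I X v (A l) \<omega>\<bar> \<le> K"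
  shows "\<bar>cemp M I X v {..z} \<omega> - cemp M I X v {..y} \<omega>\<bar> \<le> K + 2 * c * real (card I) * \<gamma>"
proof -
  have Ab[measurable]: "A l \<in> sets borel" for l using half_line_borel[OF half] .
  obtain l where l: "l < L" "A l \<subseteq> {..y}" "{..y} \<subseteq> A (Suc l)" using grid by blast
  obtain k where k: "k < L" "A k \<subseteq> {..z}" "{..z} \<subseteq> A (Suc k)" using grid by blast
  have near: "prob {\<omega> \<in> space M. (X i \<omega> \<in> A l') \<noteq> (X i \<omega> \<in> {..s})} \<le> \<gamma>"
    if l: "l < L" "A l \<subseteq> {..s}" "{..s} \<subseteq> A (Suc l)" "l' = l \<or> l' = Suc l" and i[measurable]: "i \<in> I" for l l' s i
  proof -
    have "prob {\<omega> \<in> space M. (X i \<omega> \<in> A l') \<noteq> (X i \<omega> \<in> {..s})} \<le> prob {\<omega> \<in> space M. (X i \<omega> \<in> A l) \<noteq> (X i \<omega> \<in> A (Suc l))}"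
      using l by (intro finite_measure_mono) auto
    also have "\<dots> \<le> \<gamma>" using l \<gamma>[OF l(1) i] by (subst prob_nested_diff) auto
    finally show ?thesis .
  qed
  have adm: "prob {\<omega> \<in> space M. (X i \<omega> \<in> A k') \<noteq> (X i \<omega> \<in> A l')} \<le> \<beta>"
    if k': "k' = k \<or> k' = Suc k" and l': "l' = l \<or> l' = Suc l" and i[measurable]: "i \<in> I" for i k' l'
  proof -
    have "prob {\<omega> \<in> space M. (X i \<omega> \<in> A k') \<noteq> (X i \<omega> \<in> A l')} \<le>
      prob {\<omega> \<in> space M. (X i \<omega> \<in> A k') \<noteq> (X i \<omega> \<in> {..z})} + prob {\<omega> \<in> space M. (X i \<omega> \<in> {..y}) \<noteq> (X i \<omega> \<in> {..z})}
      + prob {\<omega> \<in> space M. (X i \<omega> \<in> A l') \<noteq> (X i \<omega> \<in> {..y})}"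
      by (rule prob_Un3_le) (measurable, auto)
    then show ?thesis using near[OF k k' i] near[OF l l' i] yz[OF i] by linarith
  qed
  \<comment> \<open>The outer set for \<open>z\<close> against the inner one for \<open>y\<close>
    bounds the increment from above, the opposite combination from below.\<close>
  have "\<bar>cemp M I X v (A (Suc k)) \<omega> - cemp M I X v (A l) \<omega>\<bar> \<le> K"
    "\<bar>cemp M I X v (A k) \<omega> - cemp M I X v (A (Suc l)) \<omega>\<bar> \<le> K"
    using k l by (auto intro!: K adm)
  moreover have "cemp M I X v {..y} \<omega> \<le> cemp M I X v (A (Suc l)) \<omega> + c * real (card I) * \<gamma>"
    "cemp M I X v (A l) \<omega> \<le> cemp M I X v {..y} \<omega> + c * real (card I) * \<gamma>"
    using l by (intro cemp_sandwich[OF X _ _ _ _ _ v \<gamma>]; auto)+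
  moreover have "cemp M I X v {..z} \<omega> \<le> cemp M I X v (A (Suc k)) \<omega> + c * real (card I) * \<gamma>"
    "cemp M I X v (A k) \<omega> \<le> cemp M I X v {..z} \<omega> + c * real (card I) * \<gamma>"
    using k by (intro cemp_sandwich[OF X _ _ _ _ _ v \<gamma>]; auto)+
  ultimately show ?thesis by (simp add: abs_le_iff)
qed

end

section \<open>The tail of the supremum for one design\<close>

context prob_space
begin

lemma UN_prob_le:
  assumes "finite S" and A: "\<And>i. i \<in> S \<Longrightarrow> A i \<in> events" and b: "\<And>i. i \<in> S \<Longrightarrow> prob (A i) \<le> b"
  shows "prob (\<Union>i\<in>S. A i) \<le> real (card S) * b"
proof -
  have "prob (\<Union>i\<in>S. A i) \<le> (\<Sum>i\<in>S. prob (A i))"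
    using assms by (intro finite_measure_subadditive_finite) auto
  also have "\<dots> \<le> (\<Sum>i\<in>S. b)" by (intro sum_mono b)
  finally show ?thesis by simp
qed

text \<open>In the threshold, \<open>real R * u\<close> is the Bernstein deviation, the term with
  \<kappa> is the truncation bias, the term with \<open>N / real L\<close> is the error of the grid
  of half-lines, and the last one is the error of the grid of mesh \<open>h\<close> in the weight
  argument. The prefactor counts the grid points and pairs of half-lines.\<close>

lemma SUP_cemp_tail:
  fixes \<epsilon> :: "int \<Rightarrow> int \<Rightarrow> 'a \<Rightarrow> real" and G :: "(int \<Rightarrow> real) \<Rightarrow> real"
    and I :: "(nat \<times> nat) set" and v :: "real \<Rightarrow> nat \<times> nat \<Rightarrow> real" and X :: "nat \<times> nat \<Rightarrow> 'a \<Rightarrow> real"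
    and \<sigma> \<alpha> :: "nat \<times> nat \<Rightarrow> real" and h \<delta> \<kappa> \<theta> B c \<phi> \<tau> s0 u a b :: real and L T k :: nat
  defines "X \<equiv> (\<lambda>(i, j) \<omega>. \<alpha> (i, j) + \<sigma> (i, j) * err G \<epsilon> (int i) (int j) \<omega>)"
    and "N \<equiv> real (card I)" and "R \<equiv> 2 * k + 1"
  assumes iid: "iid_array M \<epsilon>"
    and G: "G \<in> borel_measurable (\<Pi>\<^sub>M k\<in>(UNIV :: int set). borel)"
    and B: "0 \<le> B" "\<And>i j s s'. s \<le> s' \<Longrightarrow> prob {\<omega> \<in> space M. err G \<epsilon> i j \<omega> \<in> {s..s'}} \<le> B * (s' - s)"
    and g: "g \<in> borel_measurable (\<Pi>\<^sub>M l\<in>{- int k..int k}. borel)"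
    and \<kappa>: "\<And>i j s. prob {\<omega> \<in> space M.
      (err G \<epsilon> i j \<omega> \<le> s) \<noteq> (g (\<lambda>l\<in>{- int k..int k}. \<epsilon> i (j + l) \<omega>) \<le> s)} \<le> \<kappa>"
    and I: "finite I" "I \<noteq> {}"
    and s0: "0 < s0" and \<sigma>: "\<And>p. p \<in> I \<Longrightarrow> s0 \<le> \<sigma> p"
    and v: "\<And>t p. p \<in> I \<Longrightarrow> 0 \<le> v t p \<and> v t p \<le> c"
    and supp: "\<And>t p. p \<in> I \<Longrightarrow> t \<notin> {a..b} \<Longrightarrow> v t p = 0"
    and lip: "\<And>t t' p. p \<in> I \<Longrightarrow> \<bar>v t p - v t' p\<bar> \<le> \<tau> * \<bar>t - t'\<bar>" and \<tau>: "0 \<le> \<tau>"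
    and \<phi>: "\<And>t. (\<Sum>p\<in>I. (v t p)\<^sup>2) \<le> \<phi>"
    and \<delta>: "0 < \<delta>" and L: "0 < L" and h: "0 < h" "b - a \<le> real T * h"
    and \<theta>: "0 < \<theta>" "2 * c * \<theta> \<le> 1" and u: "0 \<le> u"
  shows "prob {\<omega> \<in> space M. (SUP (d, t, y) \<in> {-\<delta>..\<delta>} \<times> UNIV \<times> UNIV.
        \<bar>cemp M I X (v t) {..y + d} \<omega> - cemp M I X (v t) {..y} \<omega>\<bar>)
        > real R * u + 2 * c * N * \<kappa> + 2 * c * N * (N / real L) + 2 * (N * (\<tau> * h))}
    \<le> real ((T + 1) * (L + 1)\<^sup>2) *
      (2 * real R * exp (\<theta>\<^sup>2 * (\<phi> * (B / s0 * \<delta> + 2 * (N / real L) + 2 * \<kappa>)) - \<theta> * u) + 2 * N * \<kappa>)"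
proof -
  define Xt where "Xt = (\<lambda>(i, j) \<omega>. \<alpha> (i, j) + \<sigma> (i, j) * g (\<lambda>l\<in>{- int k..int k}. \<epsilon> (int i) (int j + l) \<omega>))"
  define \<beta> where "\<beta> = B / s0 * \<delta> + 2 * (N / real L)"
  have N: "0 < N" using I by (simp add: N_def card_gt_0_iff)
  have c: "0 \<le> c" using v I by (metis ex_in_conv order_trans)
  have \<kappa>0: "0 \<le> \<kappa>" using \<kappa>[of 0 0 0] measure_nonneg order_trans by blast
  have \<beta>0: "0 \<le> \<beta>" unfolding \<beta>_def using B s0 \<delta> N by (intro add_nonneg_nonneg mult_nonneg_nonneg divide_nonneg_nonneg) auto
  have errm[measurable]: "random_variable borel (err G \<epsilon> i j)" for i j by (rule err_measurable[OF iid G])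
  have Xm[measurable]: "random_variable borel (X p)" for p by (cases p) (simp add: X_def)
  have \<sigma>pos: "0 < \<sigma> p" if "p \<in> I" for p using \<sigma>[OF that] s0 by linarith
  \<comment> \<open>Dividing by the positive scale turns a threshold for \<open>X\<close> into one
    for the error. Since \<kappa> is uniform in the threshold, one bound serves all locations and
    scales.\<close>
  have X_le: "X (i, j) \<omega> \<le> s \<longleftrightarrow> err G \<epsilon> (int i) (int j) \<omega> \<le> (s - \<alpha> (i, j)) / \<sigma> (i, j)"
    if "(i, j) \<in> I" for i j \<omega> s using \<sigma>pos[OF that] by (simp add: X_def field_simps)
  have Xt_le: "Xt (i, j) \<omega> \<le> s \<longleftrightarrow> g (\<lambda>l\<in>{- int k..int k}. \<epsilon> (int i) (int j + l) \<omega>) \<le> (s - \<alpha> (i, j)) / \<sigma> (i, j)"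
    if "(i, j) \<in> I" for i j \<omega> s using \<sigma>pos[OF that] by (simp add: Xt_def field_simps)
  have interval: "prob {\<omega> \<in> space M. y \<le> X p \<omega> \<and> X p \<omega> \<le> z} \<le> B / s0 * (z - y)" if p: "p \<in> I" and yz: "y \<le> z" for p y z
  proof -
    obtain i j where [simp]: "p = (i, j)" by (cases p)
    have "prob {\<omega> \<in> space M. y \<le> X p \<omega> \<and> X p \<omega> \<le> z}
      = prob {\<omega> \<in> space M. err G \<epsilon> (int i) (int j) \<omega> \<in> {(y - \<alpha> p) / \<sigma> p..(z - \<alpha> p) / \<sigma> p}}"
      using \<sigma>pos[OF p] by (intro arg_cong[of _ _ prob]) (auto simp: X_def field_simps)
    also have "\<dots> \<le> B * ((z - \<alpha> p) / \<sigma> p - (y - \<alpha> p) / \<sigma> p)"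
      using yz \<sigma>pos[OF p] by (intro B) (simp add: divide_right_mono)
    also have "\<dots> = B * ((z - y) / \<sigma> p)" by (simp add: diff_divide_distrib[symmetric])
    also have "\<dots> \<le> B * ((z - y) / s0)"
      using B yz s0 \<sigma>[OF p] by (intro mult_left_mono divide_left_mono) auto
    finally show ?thesis by simp
  qed
  have sep: "prob {\<omega> \<in> space M. (X p \<omega> \<in> {..y}) \<noteq> (X p \<omega> \<in> {..z})} \<le> B / s0 * \<bar>z - y\<bar>" if p: "p \<in> I" for p y z
  proof -
    have "prob {\<omega> \<in> space M. (X p \<omega> \<in> {..y}) \<noteq> (X p \<omega> \<in> {..z})} \<le> prob {\<omega> \<in> space M. min y z \<le> X p \<omega> \<and> X p \<omega> \<le> max y z}"
      by (intro finite_measure_mono) auto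
    also have "\<dots> \<le> B / s0 * (max y z - min y z)" by (intro interval p) auto
    also have "max y z - min y z = \<bar>z - y\<bar>" by auto
    finally show ?thesis .
  qed
  have atomless: "prob {\<omega> \<in> space M. X p \<omega> = s} = 0" if p: "p \<in> I" for p s
  proof -
    have "{\<omega> \<in> space M. X p \<omega> = s} = {\<omega> \<in> space M. s \<le> X p \<omega> \<and> X p \<omega> \<le> s}" by auto
    then show ?thesis using interval[OF p, of s s] measure_nonneg[of M] by (simp add: antisym)
  qed
  have "\<exists>A :: nat \<Rightarrow> real set. (\<forall>l. half_line (A l)) \<and> (\<forall>y. \<exists>l<L. A l \<subseteq> {..y} \<and> {..y} \<subseteq> A (Suc l)) \<and>
    (\<forall>l<L. \<forall>p\<in>I. prob {\<omega> \<in> space M. X p \<omega> \<in> A (Suc l)} - prob {\<omega> \<in> space M. X p \<omega> \<in> A l} \<le> N / real L)"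
    unfolding N_def by (rule half_line_grid[OF I Xm _ L]) (rule atomless)
  then obtain A :: "nat \<Rightarrow> real set" where A: "\<forall>l. half_line (A l)"
      "\<forall>y. \<exists>l<L. A l \<subseteq> {..y} \<and> {..y} \<subseteq> A (Suc l)"
      "\<forall>l<L. \<forall>p\<in>I. prob {\<omega> \<in> space M. X p \<omega> \<in> A (Suc l)} - prob {\<omega> \<in> space M. X p \<omega> \<in> A l} \<le> N / real L"
    by (elim exE conjE)
  note half = A(1)[rule_format] and grid = A(2)[rule_format] and mass = A(3)[rule_format]
  have Ab[measurable]: "A l \<in> sets borel" for l by (rule half_line_borel[OF half])
  have approx: "prob {\<omega> \<in> space M. (X p \<omega> \<in> S) \<noteq> (Xt p \<omega> \<in> S)} \<le> \<kappa>" if p: "p \<in> I" and S: "half_line S" for p S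
    using S unfolding half_line_def
  proof (elim disjE exE)
    fix s assume [simp]: "S = {..s}"
    obtain i j where [simp]: "p = (i, j)" by (cases p)
    show ?thesis using \<kappa>[of "int i" "int j" "(s - \<alpha> p) / \<sigma> p"] X_le Xt_le p by simp
  qed (use \<kappa>0 in auto)
  have indep: "indep_vars (\<lambda>_. borel) Xt {p \<in> I. snd p mod R = r}" for r
    using window_blocks_indep[OF iid G, of I "\<lambda>p f. \<alpha> p + \<sigma> p * g f" k r] g
    unfolding Xt_def R_def by simp
  define bad where "bad q k' l = {\<omega> \<in> space M.
    \<bar>cemp M I X (v (a + real q * h)) (A k') \<omega> - cemp M I X (v (a + real q * h)) (A l) \<omega>\<bar> > real R * u + 2 * c * N * \<kappa>}" for q k' l
  \<comment> \<open>Admissibility involves probabilities only, so this index set is nonrandom and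
    the union bound may be restricted to it.\<close>
  define S where "S = {(q, k', l). q \<le> T \<and> k' \<le> L \<and> l \<le> L \<and>
    (\<forall>p\<in>I. prob {\<omega> \<in> space M. (X p \<omega> \<in> A k') \<noteq> (X p \<omega> \<in> A l)} \<le> \<beta>)}"
  have Ssub: "S \<subseteq> {..T} \<times> {..L} \<times> {..L}" by (auto simp: S_def)
  have finS: "finite S" by (rule finite_subset[OF Ssub]) simp
  have cardS: "card S \<le> (T + 1) * (L + 1)\<^sup>2"
    using card_mono[OF _ Ssub] by (simp add: card_cartesian_product power2_eq_square)
  have [measurable]: "cemp M I X (v t) (A l) \<in> borel_measurable M" for t l
    by (rule cemp_measurable) measurable
  have badm: "bad q k' l \<in> events" for q k' l unfolding bad_def by measurable
  let ?E = "2 * real R * exp (\<theta>\<^sup>2 * (\<phi> * (\<beta> + 2 * \<kappa>)) - \<theta> * u) + 2 * N * \<kappa>"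
  have badp: "prob (bad q k' l) \<le> ?E" if "(q, k', l) \<in> S" for q k' l
    unfolding bad_def N_def
  proof (rule cemp_diff_tail[where col = "\<lambda>p. snd p mod R" and Xt = Xt])
    show "\<And>p. p \<in> I \<Longrightarrow> snd p mod R < R" by (simp add: R_def)
    show "\<And>p. p \<in> I \<Longrightarrow> prob {\<omega> \<in> space M. (X p \<omega> \<in> A k') \<noteq> (X p \<omega> \<in> A l)} \<le> \<beta>"
      using that by (auto simp: S_def)
    show "0 \<le> \<beta> + 2 * \<kappa>" using \<beta>0 \<kappa>0 by simp
  qed (rule I Xm indep Ab approx[OF _ half] v \<phi> \<theta>; assumption?)+
  have E0: "0 \<le> ?E" using N \<kappa>0 by simp
  let ?K = "real R * u + 2 * c * N * \<kappa>"
  let ?K' = "?K + 2 * c * N * (N / real L) + 2 * (N * (\<tau> * h))"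
  let ?SUP = "\<lambda>\<omega>. SUP (d, t, y) \<in> {-\<delta>..\<delta>} \<times> UNIV \<times> UNIV.
        \<bar>cemp M I X (v t) {..y + d} \<omega> - cemp M I X (v t) {..y} \<omega>\<bar>"
  have "{\<omega> \<in> space M. ?SUP \<omega> > ?K'} \<subseteq> (\<Union>(q, k', l)\<in>S. bad q k' l)"
  proof (rule subsetI, rule ccontr)
    fix \<omega> assume \<omega>: "\<omega> \<in> {\<omega> \<in> space M. ?SUP \<omega> > ?K'}" and nb: "\<omega> \<notin> (\<Union>(q, k', l)\<in>S. bad q k' l)"
    have bound: "\<bar>cemp M I X (v t) {..y + d} \<omega> - cemp M I X (v t) {..y} \<omega>\<bar> \<le> ?K'"
      if d: "- \<delta> \<le> d" "d \<le> \<delta>" for d t y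
    proof (cases "t \<in> {a..b}")
      case False
      then have "cemp M I X (v t) D \<omega> = 0" for D by (simp add: cemp_def supp)
      then show ?thesis using u c N \<kappa>0 \<tau> h by simp
    next
      case True
      \<comment> \<open>The grid point just to the left of \<open>t\<close>. The value
        \<open>q = T\<close> can occur, which is why there are \<open>T + 1\<close> grid
        points.\<close>
      define q where "q = nat \<lfloor>(t - a) / h\<rfloor>"
      have q: "real q \<le> (t - a) / h" "(t - a) / h < real q + 1"
        using True h by (auto simp: q_def)
      have "real q \<le> (b - a) / h" using q(1) True h by (smt (verit) atLeastAtMost_iff divide_right_mono)
      also have "\<dots> \<le> real T" using h by (simp add: field_simps)
      finally have qT: "q \<le> T" by simp
      have near: "\<bar>t - (a + real q * h)\<bar> \<le> h" using q h by (simp add: field_simps abs_le_iff)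
      let ?t = "a + real q * h"
      have close: "\<bar>cemp M I X (v t) D \<omega> - cemp M I X (v ?t) D \<omega>\<bar> \<le> N * (\<tau> * h)" for D
        unfolding N_def
      proof (rule cemp_lipschitz)
        fix p assume "p \<in> I"
        from lip[OF this, of t ?t] mult_left_mono[OF near \<tau>]
        show "\<bar>v t p - v ?t p\<bar> \<le> \<tau> * h" by linarith
      qed
      have "\<bar>cemp M I X (v ?t) {..y + d} \<omega> - cemp M I X (v ?t) {..y} \<omega>\<bar> \<le> ?K + 2 * c * real (card I) * (N / real L)"
      proof (rule cemp_discretise[where A = A and L = L and \<beta> = \<beta>])
        fix p assume p: "p \<in> I"
        have "B / s0 * \<bar>y + d - y\<bar> \<le> B / s0 * \<delta>" using d B s0 by (intro mult_left_mono) auto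
        then show "prob {\<omega> \<in> space M. (X p \<omega> \<in> {..y}) \<noteq> (X p \<omega> \<in> {..y + d})} + 2 * (N / real L) \<le> \<beta>"
          using sep[OF p, of y "y + d"] unfolding \<beta>_def by linarith
      next
        fix k' l assume *: "k' \<le> L" "l \<le> L" "\<And>p. p \<in> I \<Longrightarrow> prob {\<omega> \<in> space M. (X p \<omega> \<in> A k') \<noteq> (X p \<omega> \<in> A l)} \<le> \<beta>"
        then have "(q, k', l) \<in> S" using qT by (auto simp: S_def)
        then have "\<omega> \<notin> bad q k' l" using nb by blast
        then show "\<bar>cemp M I X (v ?t) (A k') \<omega> - cemp M I X (v ?t) (A l) \<omega>\<bar> \<le> ?K"
          using \<omega> by (simp add: bad_def not_less)
      qed (rule Xm half grid mass v; assumption?)+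
      then show ?thesis using close[of "{..y + d}"] close[of "{..y}"] unfolding N_def[symmetric] by linarith
    qed
    have "?SUP \<omega> \<le> ?K'"
      using \<delta> bound by (intro cSUP_least) auto
    then show False using \<omega> by simp
  qed
  then have "prob {\<omega> \<in> space M. ?SUP \<omega> > ?K'} \<le> prob (\<Union>(q, k', l)\<in>S. bad q k' l)"
    using badm finS by (intro finite_measure_mono) (auto intro!: sets.finite_UN)
  also have "\<dots> \<le> real (card S) * ?E"
    using finS badm badp by (intro UN_prob_le) auto
  also have "\<dots> \<le> real ((T + 1) * (L + 1)\<^sup>2) * ?E"
    using cardS E0 by (intro mult_right_mono) (auto simp only: of_nat_le_iff)
  finally show ?thesis unfolding \<beta>_def by simp
qed

end

section \<open>Rates\<close>

text \<open>With \<theta> = \<theta>0 sqrt(l / (\<delta> \<phi>)) and deviation U sqrt(\<delta>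
  \<phi> l), the quadratic term is at most \<theta>0^2 D l and the linear one equals \<theta>0 U l.
  The value of \<open>U\<close> makes their difference -A l.\<close>

lemma bernstein_exponent_le:
  fixes l \<delta> \<phi> \<theta>0 U D E :: real
  assumes pos: "0 < \<delta>" "0 < \<phi>" "0 \<le> l" "0 < \<theta>0" and E: "E \<le> D * \<delta>" and U: "U = (\<theta>0\<^sup>2 * D + A) / \<theta>0"
  shows "(\<theta>0 * sqrt (l / (\<delta> * \<phi>)))\<^sup>2 * (\<phi> * E) - \<theta>0 * sqrt (l / (\<delta> * \<phi>)) * (U * sqrt (\<delta> * \<phi> * l)) \<le> - (A * l)"
proof -
  have "(\<theta>0 * sqrt (l / (\<delta> * \<phi>)))\<^sup>2 * (\<phi> * E) = \<theta>0\<^sup>2 * l / \<delta> * E"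
    using pos by (simp add: power_mult_distrib)
  also have "\<dots> \<le> \<theta>0\<^sup>2 * l / \<delta> * (D * \<delta>)" using pos E by (intro mult_left_mono) auto
  also have "\<dots> = \<theta>0\<^sup>2 * l * D" using pos by simp
  finally have 1: "(\<theta>0 * sqrt (l / (\<delta> * \<phi>)))\<^sup>2 * (\<phi> * E) \<le> \<theta>0\<^sup>2 * l * D" .
  have "sqrt (l / (\<delta> * \<phi>)) * sqrt (\<delta> * \<phi> * l) = sqrt (l\<^sup>2)"
    using pos by (simp only: real_sqrt_mult[symmetric]) (simp add: power2_eq_square)
  then have "sqrt (l / (\<delta> * \<phi>)) * sqrt (\<delta> * \<phi> * l) = l" using pos by simp
  then have "\<theta>0 * sqrt (l / (\<delta> * \<phi>)) * (U * sqrt (\<delta> * \<phi> * l)) = \<theta>0 * U * l"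
    by (metis (no_types, lifting) mult.assoc mult.left_commute)
  also have "\<theta>0 * U = \<theta>0\<^sup>2 * D + A" using pos by (simp add: U)
  finally have 2: "\<theta>0 * sqrt (l / (\<delta> * \<phi>)) * (U * sqrt (\<delta> * \<phi> * l)) = (\<theta>0\<^sup>2 * D + A) * l" .
  show ?thesis using 1 unfolding 2 by (simp add: algebra_simps)
qed

text \<open>The second part lets bounded errors be absorbed: \<delta> \<phi> \<ge> l / K together
  with l \<ge> 1 bounds the rate away from zero.\<close>

lemma sqrt_cube_rate:
  fixes l \<delta> \<phi> K :: real
  assumes pos: "0 < \<delta>" "0 < \<phi>" "1 \<le> l" "1 \<le> K" and K: "l / (\<delta> * \<phi>) \<le> K"
  shows "l * sqrt (\<delta> * \<phi> * l) = sqrt (\<delta> * \<phi> * l ^ 3)" "1 \<le> K * sqrt (\<delta> * \<phi> * l ^ 3)"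
proof -
  have "sqrt (\<delta> * \<phi> * l ^ 3) = sqrt (l\<^sup>2 * (\<delta> * \<phi> * l))"
    by (simp add: power2_eq_square power3_eq_cube mult_ac)
  also have "\<dots> = l * sqrt (\<delta> * \<phi> * l)" using pos by (simp only: real_sqrt_mult) simp
  finally show eq: "l * sqrt (\<delta> * \<phi> * l) = sqrt (\<delta> * \<phi> * l ^ 3)" ..
  have lK: "l \<le> K * (\<delta> * \<phi>)" using K pos by (simp add: field_simps)
  have "1 \<le> l * l" using pos by (metis mult_mono' mult_1 zero_le_one)
  also have "\<dots> \<le> K * (\<delta> * \<phi>) * l" using lK pos by (intro mult_right_mono) auto
  also have "\<dots> \<le> K * (K * (\<delta> * \<phi> * l))"
  proof -
    have "1 * (K * (\<delta> * \<phi> * l)) \<le> K * (K * (\<delta> * \<phi> * l))" using pos by (intro mult_right_mono) auto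
    then show ?thesis by (simp add: mult_ac)
  qed
  also have "\<dots> = K\<^sup>2 * (\<delta> * \<phi> * l)" by (simp add: power2_eq_square)
  finally have "sqrt 1 \<le> sqrt (K\<^sup>2 * (\<delta> * \<phi> * l))" by (rule real_sqrt_le_mono)
  then have "1 \<le> K * sqrt (\<delta> * \<phi> * l)" using pos by (simp add: real_sqrt_mult)
  also have "\<dots> \<le> K * (l * sqrt (\<delta> * \<phi> * l))"
  proof -
    have "1 * sqrt (\<delta> * \<phi> * l) \<le> l * sqrt (\<delta> * \<phi> * l)" using pos by (intro mult_right_mono) auto
    then show ?thesis using pos by (intro mult_left_mono) auto
  qed
  finally show "1 \<le> K * sqrt (\<delta> * \<phi> * l ^ 3)" unfolding eq .
qed

text \<open>This fixes the window radius: a multiple of log N turns geometric decay in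
  \<open>k\<close> into any prescribed power of N.\<close>

lemma power_le_inverse_power:
  fixes r N :: real
  assumes r: "0 < r" "r < 1" and N: "1 \<le> N" and k: "real A / - ln r * ln N \<le> real k"
  shows "r ^ k \<le> 1 / N ^ A"
proof -
  have lr: "ln r < 0" using r by simp
  have "real A * ln N \<le> real k * - ln r" using k lr by (simp add: field_simps)
  then have "exp (real k * ln r) \<le> exp (- (real A * ln N))" by simp
  also have "\<dots> = 1 / N ^ A" using N by (simp add: exp_minus exp_of_nat_mult inverse_eq_divide)
  also have "exp (real k * ln r) = r ^ k" using r by (simp add: exp_of_nat_mult)
  finally show ?thesis .
qed

section \<open>The design as an index set, and the choice of all parameters\<close>

definition design_index :: "(nat \<Rightarrow> nat \<Rightarrow> nat) \<Rightarrow> nat \<Rightarrow> (nat \<times> nat) set" where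
  "design_index m n = (SIGMA i:{1..n}. {1..m n i})"

lemma finite_design_index [simp]: "finite (design_index m n)"
  by (simp add: design_index_def)

lemma card_design_index: "card (design_index m n) = Nobs m n"
  by (simp add: design_index_def Nobs_def)

lemma (in prob_space) Demp_eq_cemp:
  assumes Y: "\<And>i j. (i, j) \<in> design_index m n \<Longrightarrow> random_variable borel (Y n i j)"
  shows "Demp M m w Y n d t y \<omega> =
    cemp M (design_index m n) (\<lambda>(i, j). Y n i j) (\<lambda>(i, j). w n i j t) {..y + d} \<omega> -
    cemp M (design_index m n) (\<lambda>(i, j). Y n i j) (\<lambda>(i, j). w n i j t) {..y} \<omega>"
proof -
  have F: "Femp m w Y n t y \<omega> = (\<Sum>(i, j)\<in>design_index m n. w n i j t * indicat_real {..y} (Y n i j \<omega>))" for y \<omega>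
    unfolding Femp_def design_index_def by (rule sum.Sigma) auto
  have int: "integrable M (\<lambda>\<omega>. indicat_real {..y} (Y n i j \<omega>))"
    and exp: "expectation (\<lambda>\<omega>. indicat_real {..y} (Y n i j \<omega>)) = prob {\<omega> \<in> space M. Y n i j \<omega> \<in> {..y}}"
    if "(i, j) \<in> design_index m n" for i j y
  proof -
    note [measurable] = Y[OF that]
    show "integrable M (\<lambda>\<omega>. indicat_real {..y} (Y n i j \<omega>))"
      by (intro integrable_const_bound[of _ 1]) (auto simp: indicator_def)
    have "expectation (\<lambda>\<omega>. indicat_real {..y} (Y n i j \<omega>)) = expectation (indicat_real {\<omega> \<in> space M. Y n i j \<omega> \<in> {..y}})"
      by (intro Bochner_Integration.integral_cong) (auto simp: indicator_def)
    then show "expectation (\<lambda>\<omega>. indicat_real {..y} (Y n i j \<omega>)) = prob {\<omega> \<in> space M. Y n i j \<omega> \<in> {..y}}"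
      by simp
  qed
  have E: "expectation (\<lambda>\<omega>. Femp m w Y n t y \<omega>) =
      (\<Sum>(i, j)\<in>design_index m n. w n i j t * prob {\<omega> \<in> space M. Y n i j \<omega> \<in> {..y}})" for y
    unfolding F by (subst Bochner_Integration.integral_sum) (auto simp: int exp intro!: sum.cong)
  have "Femp m w Y n t y \<omega> - expectation (\<lambda>\<omega>. Femp m w Y n t y \<omega>) =
    cemp M (design_index m n) (\<lambda>(i, j). Y n i j) (\<lambda>(i, j). w n i j t) {..y} \<omega>" for y
    unfolding E unfolding F cemp_def sum_subtractf[symmetric]
    by (intro sum.cong) (auto simp: right_diff_distrib)
  then show ?thesis by (simp add: Demp_def)
qed

theorem theorem3p3:
  fixes M :: "'a measure"
    and \<epsilon> :: "int \<Rightarrow> int \<Rightarrow> 'a \<Rightarrow> real"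
    and G :: "(int \<Rightarrow> real) \<Rightarrow> real"
    and \<mu> s :: "real \<Rightarrow> real"
    and m :: "nat \<Rightarrow> nat \<Rightarrow> nat"
    and x :: "nat \<Rightarrow> nat \<Rightarrow> nat \<Rightarrow> real"
    and w :: "nat \<Rightarrow> nat \<Rightarrow> nat \<Rightarrow> real \<Rightarrow> real"
    and \<delta> \<tau> \<phi> :: "nat \<Rightarrow> real"
    and c a b b\<^sub>\<mu> s\<^sub>0 s\<^sub>1 :: real
    and p :: nat
  defines "Y \<equiv> resp \<mu> s x (err G \<epsilon>)"
  assumes "prob_space M"
    and iid: "iid_array M \<epsilon>"
    and G_meas: "G \<in> borel_measurable (\<Pi>\<^sub>M k\<in>(UNIV :: int set). borel)"
    and D: "condition_D (distr M borel (\<epsilon> 0 0)) G"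
    and density: "has_bounded_density M (err G \<epsilon> 0 0)"
    and N_lim: "filterlim (Nobs m) at_top sequentially"
    and w_nonneg: "\<And>n i j t. i \<in> {1..n} \<Longrightarrow> j \<in> {1..m n i} \<Longrightarrow> 0 \<le> w n i j t"
    and a_w: "\<And>n i j t. i \<in> {1..n} \<Longrightarrow> j \<in> {1..m n i} \<Longrightarrow> w n i j t \<le> c"
    and a_\<mu>: "\<And>n i j. i \<in> {1..n} \<Longrightarrow> j \<in> {1..m n i} \<Longrightarrow> \<bar>\<mu> (x n i j)\<bar> \<le> b\<^sub>\<mu>"
    and a_s0: "0 < s\<^sub>0"
    and a_s: "\<And>n i j. i \<in> {1..n} \<Longrightarrow> j \<in> {1..m n i} \<Longrightarrow> s\<^sub>0 \<le> s (x n i j) \<and> s (x n i j) \<le> s\<^sub>1"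
    and b_supp: "\<And>n i j t. i \<in> {1..n} \<Longrightarrow> j \<in> {1..m n i} \<Longrightarrow> t \<notin> {a..b} \<Longrightarrow> w n i j t = 0"
    and b_lip: "\<And>n i j t t'. i \<in> {1..n} \<Longrightarrow> j \<in> {1..m n i} \<Longrightarrow> t \<noteq> t' \<Longrightarrow>
                  \<bar>w n i j t - w n i j t'\<bar> / \<bar>t - t'\<bar> \<le> \<tau> n"
    and b_sq: "\<And>n t. n \<ge> 1 \<Longrightarrow> (\<Sum>i=1..n. \<Sum>j=1..m n i. (w n i j t)\<^sup>2) \<le> \<phi> n"
    and c_pos: "\<And>n. n \<ge> 1 \<Longrightarrow> 0 < \<delta> n \<and> 0 < \<phi> n"
    and c_lim: "\<delta> \<longlonglongrightarrow> 0"
    and c_sup: "bdd_above ((\<lambda>n. ln (real (Nobs m n)) / (\<delta> n * \<phi> n)) ` {1..})"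
    and c_poly: "(\<lambda>n. 1 / \<delta> n + \<tau> n) \<in> O(\<lambda>n. real (Nobs m n) ^ p)"
  shows "bigO_p M
           (\<lambda>n \<omega>. SUP (d, t, y) \<in> {-\<delta> n..\<delta> n} \<times> UNIV \<times> UNIV. \<bar>Demp M m w Y n d t y \<omega>\<bar>)
           (\<lambda>n. sqrt (\<delta> n * \<phi> n * ln (real (Nobs m n)) ^ 3))"
proof -
  interpret prob_space M by fact
  define I where "I n = design_index m n" for n
  define N where "N n = real (Nobs m n)" for n
  define X where "X n = (\<lambda>(i, j). Y n i j)" for n
  define v where "v n t = (\<lambda>(i, j). w n i j t)" for n t
  define S where "S n \<omega> = (SUP (d, t, y) \<in> {-\<delta> n..\<delta> n} \<times> UNIV \<times> UNIV.
    \<bar>cemp M (I n) (X n) (v n t) {..y + d} \<omega> - cemp M (I n) (X n) (v n t) {..y} \<omega>\<bar>)" for n \<omega>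
  define a\<^sub>n where "a\<^sub>n n = sqrt (\<delta> n * \<phi> n * ln (N n) ^ 3)" for n
  have I_iff: "(i, j) \<in> I n \<longleftrightarrow> i \<in> {1..n} \<and> j \<in> {1..m n i}" for i j n
    by (auto simp: I_def design_index_def)
  have cardI: "real (card (I n)) = N n" for n by (simp add: I_def N_def card_design_index)
  have Ym: "random_variable borel (Y n i j)" for n i j
    using err_measurable[OF iid G_meas, of "int i" "int j"] by (simp add: Y_def resp_def[abs_def])
  have Xm: "random_variable borel (X n p)" for n p by (cases p) (simp add: X_def Ym)
  have Demp_eq: "Demp M m w Y n d t y \<omega> = cemp M (I n) (X n) (v n t) {..y + d} \<omega> - cemp M (I n) (X n) (v n t) {..y} \<omega>"
    for n d t y \<omega> unfolding X_def v_def I_def by (rule Demp_eq_cemp) (rule Ym)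
  have v: "0 \<le> v n t p \<and> v n t p \<le> max c 1" if "p \<in> I n" for n t p
  proof (cases p)
    case (Pair i j)
    then have "i \<in> {1..n}" "j \<in> {1..m n i}" using that by (auto simp: I_iff)
    from w_nonneg[OF this, of t] a_w[OF this, of t] show ?thesis by (simp add: Pair v_def)
  qed
  have v_supp: "v n t p = 0" if "p \<in> I n" "t \<notin> {a..b}" for n t p
    using that b_supp by (cases p) (simp add: I_iff v_def)
  have v_lip: "\<bar>v n t p - v n t' p\<bar> \<le> \<tau> n * \<bar>t - t'\<bar>" if "p \<in> I n" for n t t' p
  proof (cases "t = t'")
    case False
    obtain i j where p: "p = (i, j)" by (cases p)
    have "\<bar>w n i j t - w n i j t'\<bar> / \<bar>t - t'\<bar> \<le> \<tau> n" using that False by (intro b_lip) (auto simp: p I_iff)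
    then show ?thesis using False by (simp add: p v_def divide_le_eq)
  qed simp
  have v_cont: "isCont (\<lambda>t. v n t p) t" if "p \<in> I n" for n t p
  proof -
    have "(max 0 (\<tau> n))-lipschitz_on UNIV (\<lambda>t. v n t p)"
    proof (rule lipschitz_onI)
      fix t t' :: real
      show "dist (v n t p) (v n t' p) \<le> max 0 (\<tau> n) * dist t t'"
        using v_lip[OF that, of t t'] mult_right_mono[of "\<tau> n" "max 0 (\<tau> n)" "\<bar>t - t'\<bar>"]
        by (simp add: dist_real_def)
    qed simp
    then show ?thesis using lipschitz_on_continuous_on continuous_on_eq_continuous_at by blast
  qed
  have v_sq: "(\<Sum>p\<in>I n. (v n t p)\<^sup>2) \<le> \<phi> n" if "n \<ge> 1" for n t
  proof -
    have "(\<Sum>i=1..n. \<Sum>j=1..m n i. (w n i j t)\<^sup>2) = (\<Sum>(i, j)\<in>I n. (w n i j t)\<^sup>2)"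
      unfolding I_def design_index_def by (rule sum.Sigma) auto
    then show ?thesis using b_sq[OF that, of t] by (simp add: v_def case_prod_beta)
  qed
  have cemp_bound: "\<bar>cemp M (I n) (X n) (v n t) D \<omega>\<bar> \<le> N n * max c 1" for n t D \<omega>
    using cemp_abs_le[of "I n" "v n t" "max c 1" "X n" D \<omega>] v by (simp add: cardI)
  have S_eq: "(SUP (d, t, y) \<in> {-\<delta> n..\<delta> n} \<times> UNIV \<times> UNIV. \<bar>Demp M m w Y n d t y \<omega>\<bar>) = S n \<omega>" for n \<omega>
    by (simp add: S_def Demp_eq)
  have S_meas: "S n \<in> borel_measurable M" for n
  \<comment> \<open>Measurability is required for every \<open>n\<close>, but \<delta> is known to
    be positive only for n \<ge> 1. The design with n = 0 is empty and gives a constant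
    function.\<close>
  proof (cases "n = 0")
    case True
    then have "cemp M (I n) (X n) (v n t) D \<omega> = 0" for t D \<omega> by (simp add: cemp_def I_def design_index_def)
    then show ?thesis by (simp add: S_def[abs_def])
  next
    case False
    have "(\<lambda>\<omega>. SUP (d, t, y) \<in> {-\<delta> n..\<delta> n} \<times> UNIV \<times> UNIV.
      \<bar>cemp M (I n) (X n) (v n t) {..y + d} \<omega> - cemp M (I n) (X n) (v n t) {..y} \<omega>\<bar>) \<in> borel_measurable M"
    proof (rule SUP_window_measurable[where Z = "\<lambda>t y. cemp M (I n) (X n) (v n t) {..y}", OF _ _ cemp_bound])
      show "0 < \<delta> n" using c_pos False by simp
      show "cemp M (I n) (X n) (v n t) {..y} \<in> borel_measurable M" for t y
        by (rule cemp_measurable) (auto intro: Xm)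
      show "((\<lambda>(t', y'). cemp M (I n) (X n) (v n t') {..y'} \<omega>) \<longlongrightarrow> cemp M (I n) (X n) (v n t) {..y} \<omega>) (nhds t \<times>\<^sub>F at_right y)"
        for t y \<omega> by (rule cemp_right_cont) (auto intro: Xm v_cont)
    qed
    then show ?thesis by (simp add: S_def[abs_def])
  qed
  have S_nonneg: "0 \<le> S n \<omega>" if "n \<ge> 1" for n \<omega>
  proof -
    let ?f = "\<lambda>(d, t, y). \<bar>cemp M (I n) (X n) (v n t) {..y + d} \<omega> - cemp M (I n) (X n) (v n t) {..y} \<omega>\<bar>"
    have "?f z \<le> 2 * (N n * max c 1)" for z
    proof (cases z)
      case (fields d t y)
      then show ?thesis
        using cemp_bound[of n t "{..y + d}" \<omega>] cemp_bound[of n t "{..y}" \<omega>] by simp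
    qed
    then have "bdd_above (?f ` ({-\<delta> n..\<delta> n} \<times> UNIV \<times> UNIV))"
      by (intro bdd_aboveI[of _ "2 * (N n * max c 1)"]) blast
    then have "?f (0, 0, 0) \<le> S n \<omega>" unfolding S_def
      using c_pos[OF that] by (intro cSUP_upper) auto
    then show ?thesis by simp
  qed
  obtain B where B: "B \<ge> 0"
    and Bb: "\<And>i j s s'. s \<le> s' \<Longrightarrow> prob {\<omega> \<in> space M. err G \<epsilon> i j \<omega> \<in> {s..s'}} \<le> B * (s' - s)"
    using err_prob_interval[OF iid G_meas density] by blast
  obtain C r where C: "0 < C" and r: "0 < r" "r < 1" and ev:
    "\<forall>\<^sub>F k in sequentially. \<exists>g\<in>borel_measurable (\<Pi>\<^sub>M l\<in>{- int k..int k}. borel). \<forall>i j s.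
       prob {\<omega> \<in> space M. (err G \<epsilon> i j \<omega> \<le> s) \<noteq> (g (\<lambda>l\<in>{- int k..int k}. \<epsilon> i (j + l) \<omega>) \<le> s)} \<le> C * r ^ k"
    using err_threshold_approx[OF iid G_meas D density] by blast
  then obtain k0 where k0: "\<And>k. k \<ge> k0 \<Longrightarrow> \<exists>g\<in>borel_measurable (\<Pi>\<^sub>M l\<in>{- int k..int k}. borel). \<forall>i j s.
       prob {\<omega> \<in> space M. (err G \<epsilon> i j \<omega> \<le> s) \<noteq> (g (\<lambda>l\<in>{- int k..int k}. \<epsilon> i (j + l) \<omega>) \<le> s)} \<le> C * r ^ k"
    unfolding eventually_sequentially by blast
  obtain K1 where K1: "\<And>n. n \<ge> 1 \<Longrightarrow> ln (N n) / (\<delta> n * \<phi> n) \<le> K1"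
    using c_sup unfolding bdd_above_def N_def by auto
  define K where "K = max 1 K1"
  have K: "1 \<le> K" "\<And>n. n \<ge> 1 \<Longrightarrow> ln (N n) / (\<delta> n * \<phi> n) \<le> K" using K1 by (force simp: K_def)+
  obtain C0 where C0: "0 < C0" and poly: "\<forall>\<^sub>F n in sequentially. norm (1 / \<delta> n + \<tau> n) \<le> C0 * norm (N n ^ p)"
    using landau_o.bigE[OF c_poly] unfolding N_def by blast
  \<comment> \<open>The grids have order N^(p+1) points and N^(2(p+2)) pairs, and the bracket of the
    tail bound contributes one more N, in total N^(3p+6). One further power leaves a probability of
    order 1/N.\<close>
  define A where "A = 3 * p + 7"
  \<comment> \<open>The exponent A + 1 instead of A absorbs the constant \<open>C\<close> of the
    truncation bound, once N \<ge> C.\<close>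
  define \<kappa>0 where "\<kappa>0 = real (A + 1) / - ln r"
  have \<kappa>0: "0 < \<kappa>0" using r by (simp add: \<kappa>0_def divide_pos_neg)
  \<comment> \<open>From R = 2k+1 \<le> 2(\<kappa>0 log N + 1) + 1 and log N \<ge> 1.\<close>
  define K2 where "K2 = 2 * \<kappa>0 + 3"
  \<comment> \<open>Positive even if the weight bound \<open>c\<close> is 0, so that \<theta>0 is
    well defined.\<close>
  define c' where "c' = max c 1"
  have c': "1 \<le> c'" by (simp add: c'_def)
  \<comment> \<open>Exactly what makes 2 c' \<theta> \<le> 1 when log N / (\<delta> \<phi>) \<le>
    K.\<close>
  define \<theta>0 where "\<theta>0 = 1 / (2 * c' * sqrt K)"
  have \<theta>0: "0 < \<theta>0" using c' K by (simp add: \<theta>0_def)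
  \<comment> \<open>The density contributes B / s0; the grid and the truncation contribute twice a
    negative power of N each, and both powers are at most \<delta>.\<close>
  define E where "E = B / s\<^sub>0 + 4"
  define U where "U = (\<theta>0\<^sup>2 * E + real A) / \<theta>0"
  have U: "0 \<le> U" using \<theta>0 B a_s0 by (auto simp: U_def E_def intro!: divide_nonneg_pos add_nonneg_nonneg mult_nonneg_nonneg)
  \<comment> \<open>The first summand is the Bernstein deviation times the number of classes; the
    second absorbs the three bounded errors at the cost of the factor \<open>K\<close>.\<close>
  define Cfin where "Cfin = K2 * U + (4 * c' + 2 * C0) * K"
  define Kp where "Kp = 8 * (K2 + 1) * (\<bar>b - a\<bar> + 2)"
  \<comment> \<open>In this order the entries ensure log N \<ge> 1, absorb \<open>C\<close>, absorb
    \<open>C0\<close> in the lower bound for \<delta>, and make the window radius at least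
    \<open>k0\<close>.\<close>
  define N0 where "N0 = Max {exp 1, C, C0, exp (real k0 / \<kappa>0)}"
  have Ntop: "filterlim N at_top sequentially"
    unfolding N_def by (rule filterlim_compose[OF filterlim_real_sequentially N_lim])
  have "\<forall>\<^sub>F n in sequentially. N n \<ge> N0" using Ntop by (simp add: filterlim_at_top)
  then have tail: "\<forall>\<^sub>F n in sequentially. prob {\<omega> \<in> space M. S n \<omega> > Cfin * a\<^sub>n n} \<le> Kp / N n"
    using poly eventually_ge_at_top[of "1::nat"]
  proof eventually_elim
    case (elim n)
    note n = elim(3)
    have N0: "exp 1 \<le> N n" "C \<le> N n" "C0 \<le> N n" "exp (real k0 / \<kappa>0) \<le> N n"
      using elim(1) by (auto simp: N0_def)
    have Npos: "0 < N n" using N0(1) exp_gt_zero[of "1::real"] by linarith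
    have l1: "1 \<le> ln (N n)" using N0(1) Npos by (simp add: ln_ge_iff)
    have N1: "1 \<le> N n" using N0(1) exp_ge_add_one_self[of "1::real"] by linarith
    have lN: "ln (N n) \<le> N n" using ln_le_minus_one[OF Npos] by linarith
    have In: "I n \<noteq> {}" using cardI[of n] Npos by auto
    \<comment> \<open>The sign follows from the Lipschitz bound because the design is nonempty; it
      allows 1/\<delta> and \<tau> to be bounded separately by their sum.\<close>
    have \<tau>: "0 \<le> \<tau> n"
    proof -
      obtain p where "p \<in> I n" using In by blast
      from v_lip[OF this, of 1 0] show ?thesis by (simp add: order_trans[OF abs_ge_zero])
    qed
    have \<delta>: "0 < \<delta> n" and \<phi>: "0 < \<phi> n" using c_pos[OF n] by auto
    have "1 / \<delta> n + \<tau> n \<le> C0 * N n ^ p" using elim(2) \<delta> \<tau> Npos by simp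
    then have \<delta>_ge: "1 / \<delta> n \<le> C0 * N n ^ p" and \<tau>_le: "\<tau> n \<le> C0 * N n ^ p" using \<delta> \<tau> by (auto intro: order_trans[rotated])
    define k where "k = nat \<lceil>\<kappa>0 * ln (N n)\<rceil>"
    have k: "\<kappa>0 * ln (N n) \<le> real k" "real k \<le> \<kappa>0 * ln (N n) + 1"
      using \<kappa>0 l1 by (auto simp: k_def)
    have "real k0 / \<kappa>0 \<le> ln (N n)" using N0(4) Npos by (simp add: ln_ge_iff)
    then have "real k0 \<le> real k" using k(1) \<kappa>0 by (simp add: field_simps)
    then have "k0 \<le> k" by simp
    from k0[OF this] obtain g where g: "g \<in> borel_measurable (\<Pi>\<^sub>M l\<in>{- int k..int k}. borel)"
      and gb: "\<And>i j s. prob {\<omega> \<in> space M. (err G \<epsilon> i j \<omega> \<le> s) \<noteq> (g (\<lambda>l\<in>{- int k..int k}. \<epsilon> i (j + l) \<omega>) \<le> s)} \<le> C * r ^ k"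
      by blast
    have "C * r ^ k \<le> N n * (1 / N n ^ (A + 1))"
      using N0(2) C r k(1) N1 by (intro mult_mono power_le_inverse_power) (auto simp: \<kappa>0_def)
    also have "\<dots> = 1 / N n ^ A" using Npos by simp
    finally have Crk: "C * r ^ k \<le> 1 / N n ^ A" .
    define R where "R = 2 * k + 1"
    have R: "real R \<le> K2 * ln (N n)"
      using k(2) l1 by (simp add: R_def K2_def algebra_simps)
    have K2: "0 \<le> K2" using \<kappa>0 by (simp add: K2_def)
    have RN: "real R \<le> K2 * N n" using R mult_left_mono[OF lN K2] by linarith
    \<comment> \<open>The exponent makes the cell mass N / L at most \<delta>, so the grid does not
      raise the order of the variance, and N (N / L) \<le> 1.\<close>
    define L where "L = Nobs m n ^ (p + 2)"
    have L: "real L = N n ^ (p + 2)" by (simp add: L_def N_def)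
    have NL: "N n / real L = 1 / N n ^ (p + 1)" using Npos by (simp add: L)
    \<comment> \<open>Compensates the polynomial growth of \<tau>: N \<tau> h \<le> C0.\<close>
    define h where "h = 1 / N n ^ (p + 1)"
    have h: "0 < h" using Npos by (simp add: h_def)
    \<comment> \<open>If b < a, then \<open>nat\<close> gives T = 0, consistent with an empty
      support interval.\<close>
    define T where "T = nat \<lceil>(b - a) / h\<rceil>"
    have T1: "b - a \<le> real T * h"
    proof -
      have "(b - a) / h \<le> real T" unfolding T_def by (rule real_nat_ceiling_ge)
      then show ?thesis using h by (simp add: field_simps)
    qed
    have "real T \<le> \<bar>b - a\<bar> / h + 1"
    proof -
      have "real T \<le> \<bar>(b - a) / h\<bar> + 1" unfolding T_def by linarith
      then show ?thesis using h by (simp add: abs_divide)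
    qed
    then have T2: "real T + 1 \<le> (\<bar>b - a\<bar> + 2) * N n ^ (p + 1)"
      using one_le_power[OF N1, of "p + 1"] by (simp add: h_def algebra_simps)
    have Np: "1 / N n ^ (p + 1) \<le> \<delta> n"
    proof -
      have "C0 * N n ^ p \<le> N n * N n ^ p" using N0(3) Npos by (intro mult_right_mono) auto
      then have "1 / \<delta> n \<le> N n * N n ^ p" using \<delta>_ge by linarith
      then show ?thesis using \<delta> Npos by (simp add: field_simps)
    qed
    have NA: "1 / N n ^ A \<le> 1 / N n ^ (p + 1)"
      using N1 Npos by (intro divide_left_mono power_increasing) (auto simp: A_def)
    define \<theta> where "\<theta> = \<theta>0 * sqrt (ln (N n) / (\<delta> n * \<phi> n))"
    define u where "u = U * sqrt (\<delta> n * \<phi> n * ln (N n))"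
    have \<theta>: "0 < \<theta>" "2 * c' * \<theta> \<le> 1"
    proof -
      show "0 < \<theta>" using \<theta>0 \<delta> \<phi> l1 by (simp add: \<theta>_def)
      have "2 * c' * \<theta> \<le> 2 * c' * (\<theta>0 * sqrt K)"
        unfolding \<theta>_def using K n c' \<theta>0 by (intro mult_left_mono) auto
      also have "\<dots> = 1" using c' K by (simp add: \<theta>0_def)
      finally show "2 * c' * \<theta> \<le> 1" .
    qed
    have u: "0 \<le> u" using U \<delta> \<phi> l1 by (simp add: u_def)
    define Ex where "Ex = B / s\<^sub>0 * \<delta> n + 2 * (N n / real L) + 2 * (1 / N n ^ A)"
    have "Ex \<le> E * \<delta> n"
      using Np NA unfolding Ex_def E_def NL by (simp add: distrib_right)
    then have "\<theta>\<^sup>2 * (\<phi> n * Ex) - \<theta> * u \<le> - (real A * ln (N n))"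
      unfolding \<theta>_def u_def using \<delta> \<phi> l1 \<theta>0 by (intro bernstein_exponent_le[where D = E]) (auto simp: U_def)
    then have "exp (\<theta>\<^sup>2 * (\<phi> n * Ex) - \<theta> * u) \<le> exp (- (real A * ln (N n)))" by simp
    also have "\<dots> = 1 / N n ^ A" using Npos by (simp add: exp_minus exp_of_nat_mult inverse_eq_divide)
    finally have expo: "exp (\<theta>\<^sup>2 * (\<phi> n * Ex) - \<theta> * u) \<le> 1 / N n ^ A" .
    have Xn: "X n = (\<lambda>(i, j) \<omega>. (\<lambda>p. \<mu> (x n (fst p) (snd p))) (i, j) + (\<lambda>p. s (x n (fst p) (snd p))) (i, j) * err G \<epsilon> (int i) (int j) \<omega>)"
      by (auto simp: X_def Y_def resp_def fun_eq_iff)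
    let ?thr = "real R * u + 2 * c' * N n * (1 / N n ^ A) + 2 * c' * N n * (N n / real L) + 2 * (N n * (\<tau> n * h))"
    have main: "prob {\<omega> \<in> space M. S n \<omega> > ?thr} \<le> real ((T + 1) * (L + 1)\<^sup>2) *
      (2 * real R * exp (\<theta>\<^sup>2 * (\<phi> n * Ex) - \<theta> * u) + 2 * N n * (1 / N n ^ A))"
      unfolding S_def Xn Ex_def R_def cardI[symmetric]
    proof (rule SUP_cemp_tail[OF iid G_meas B Bb g])
      show "prob {\<omega> \<in> space M. (err G \<epsilon> i j \<omega> \<le> s) \<noteq> (g (\<lambda>l\<in>{- int k..int k}. \<epsilon> i (j + l) \<omega>) \<le> s)} \<le> 1 / real (card (I n)) ^ A"
        for i j s using gb[of i j s] Crk by (simp add: cardI)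
      show "finite (I n)" by (simp add: I_def)
      show "s\<^sub>0 \<le> s (x n (fst p) (snd p))" if "p \<in> I n" for p
        using that a_s by (cases p) (simp add: I_iff)
      show "0 < L" using L Npos by (metis of_nat_0_less_iff zero_less_power)
    qed (use In a_s0 v v_supp v_lip \<tau> v_sq[OF n] \<delta> h T1 \<theta> u in \<open>auto simp: c'_def\<close>)
    have "?thr \<le> Cfin * a\<^sub>n n"
    proof -
      note rate = sqrt_cube_rate[OF \<delta> \<phi> l1 K(1) K(2)[OF n]]
      have "real R * u \<le> K2 * ln (N n) * u" using R u by (intro mult_right_mono) auto
      also have "\<dots> = K2 * U * a\<^sub>n n" unfolding u_def a\<^sub>n_def rate(1)[symmetric] by simp
      finally have 1: "real R * u \<le> K2 * U * a\<^sub>n n" .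
      have "N n ^ 1 \<le> N n ^ A" using N1 by (intro power_increasing) (auto simp: A_def)
      then have 2: "N n * (1 / N n ^ A) \<le> 1" using Npos by simp
      have 3: "N n * (N n / real L) \<le> 1" using one_le_power[OF N1, of p] Npos by (simp add: NL)
      have 4: "N n * (\<tau> n * h) \<le> C0" using \<tau>_le Npos by (simp add: h_def field_simps)
      have "2 * c' * (N n * (1 / N n ^ A)) + 2 * c' * (N n * (N n / real L)) + 2 * (N n * (\<tau> n * h))
          \<le> 2 * c' * 1 + 2 * c' * 1 + 2 * C0"
        using 2 3 4 c' by (intro add_mono mult_left_mono) auto
      also have "\<dots> = (4 * c' + 2 * C0) * 1" by simp
      also have "\<dots> \<le> (4 * c' + 2 * C0) * (K * a\<^sub>n n)"
        using rate(2) c' C0 unfolding a\<^sub>n_def by (intro mult_left_mono) auto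
      finally show ?thesis using 1 by (simp add: Cfin_def distrib_right mult.assoc)
    qed
    then have "prob {\<omega> \<in> space M. S n \<omega> > Cfin * a\<^sub>n n} \<le> prob {\<omega> \<in> space M. S n \<omega> > ?thr}"
      using S_meas by (intro finite_measure_mono) auto
    also note main
    also have "real ((T + 1) * (L + 1)\<^sup>2) * (2 * real R * exp (\<theta>\<^sup>2 * (\<phi> n * Ex) - \<theta> * u) + 2 * N n * (1 / N n ^ A))
      \<le> ((\<bar>b - a\<bar> + 2) * N n ^ (p + 1) * (2 * N n ^ (p + 2))\<^sup>2) * (2 * (K2 * N n) * (1 / N n ^ A) + 2 * N n * (1 / N n ^ A))"
    proof (intro mult_mono add_mono)
      have "real L + 1 \<le> 2 * N n ^ (p + 2)" using one_le_power[OF N1, of "p + 2"] by (simp only: L)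
      then have "(real L + 1)\<^sup>2 \<le> (2 * N n ^ (p + 2))\<^sup>2" by (intro power_mono) auto
      then have "(real T + 1) * (real L + 1)\<^sup>2 \<le> (\<bar>b - a\<bar> + 2) * N n ^ (p + 1) * (2 * N n ^ (p + 2))\<^sup>2"
        using T2 by (intro mult_mono) auto
      then show "real ((T + 1) * (L + 1)\<^sup>2) \<le> (\<bar>b - a\<bar> + 2) * N n ^ (p + 1) * (2 * N n ^ (p + 2))\<^sup>2"
        by (simp add: algebra_simps)
    qed (use RN expo Npos K2 in auto)
    also have "\<dots> = Kp / N n"
    proof -
      have "A = (p + 1) + (p + 2) * 2 + 1 + 1" by (simp add: A_def)
      then have "N n ^ (p + 1) * (N n ^ (p + 2))\<^sup>2 * N n * N n = N n ^ A"
        by (simp only: power_add power_mult power_one_right)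
      then have "N n ^ (p + 1) * (N n ^ (p + 2))\<^sup>2 * N n * (1 / N n ^ A) = 1 / N n"
        using Npos by (simp add: field_simps)
      moreover have "d * P * (2 * Q)\<^sup>2 * (2 * (K2 * M) * Z + 2 * M * Z) = 8 * (K2 + 1) * d * (P * Q\<^sup>2 * M * Z)"
        for d P Q M Z :: real by (simp add: algebra_simps power2_eq_square)
      ultimately show ?thesis unfolding Kp_def by (simp only:) simp
    qed
    finally show ?case .
  qed
  have "0 \<le> K2 * U" using U \<kappa>0 by (simp add: K2_def)
  moreover have "0 < (4 * c' + 2 * C0) * K" using c' C0 K(1) by (intro mult_pos_pos) auto
  ultimately have Cfin: "0 < Cfin" by (simp add: Cfin_def)
  have "((\<lambda>n. Kp / N n) \<longlongrightarrow> 0) sequentially"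
    using Ntop by (intro tendsto_divide_0[OF tendsto_const] filterlim_at_top_imp_at_infinity)
  have "\<exists>C>0. \<forall>\<^sub>F n in sequentially. prob {\<omega> \<in> space M. \<bar>S n \<omega>\<bar> > C * a\<^sub>n n} \<le> \<eta>" if "\<eta> > 0" for \<eta>
  \<comment> \<open>The tail bound itself tends to 0, so the same constant works for every
    \<eta>.\<close>
  proof (intro exI[of _ Cfin] conjI Cfin)
    have "\<forall>\<^sub>F n in sequentially. Kp / N n < \<eta>"
      using order_tendstoD(2)[OF \<open>((\<lambda>n. Kp / N n) \<longlongrightarrow> 0) sequentially\<close>] that by blast
    then show "\<forall>\<^sub>F n in sequentially. prob {\<omega> \<in> space M. \<bar>S n \<omega>\<bar> > Cfin * a\<^sub>n n} \<le> \<eta>"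
      using tail eventually_ge_at_top[of "1::nat"]
      by eventually_elim (simp add: S_nonneg abs_of_nonneg)
  qed
  then show ?thesis
    unfolding bigO_p_def S_eq using S_meas by (auto simp: a\<^sub>n_def N_def)
qed

end
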